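(* Let $n\ge 1$ and let $k_1,\dots,k_I$ be positive integers with $k_1+\cdots+k_I=n$. Let $\mathcal N(k_1,\dots,k_I)$ be the set of all normal complex $n\times n$ matrices which have exactly $I$ distinct eigenvalues, with multiplicities $k_1,\dots,k_I$ (the values of the eigenvalues being otherwise unrestricted). Then the real dimension of $\mathcal N(k_1,\dots,k_I)$ is $$n^2-\sum_{i=1}^I k_i^2+2I.$$
   Context: A complex $n\times n$ matrix $A$ is normal if $AA^\ast=A^\ast A$, where $A^\ast$ is the adjoint (conjugate transpose). "Real dimension" of a subset of the space of complex $n\times n$ matrices (viewed as a real vector space of dimension $2n^2$) is the usual dimension over $\mathbb R$ (of a real manifold, or of a semialgebraic set). *)

theory Defs
  imports
    "HOL-Analysis.Analysis"
    "HOL-Homology.Invariance_of_Domain"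
    "HOL-Computational_Algebra.Polynomial"
begin

subsection \<open>Real dimension\<close>

definition manifold_of_dim :: "nat \<Rightarrow> 'a::euclidean_space set \<Rightarrow> bool" where
  "manifold_of_dim d S \<longleftrightarrow>
     (\<forall>x\<in>S. \<exists>V U. openin (top_of_set S) V \<and> x \<in> V \<and> openin (Euclidean_space d) U \<and>
        top_of_set V homeomorphic_space subtopology (Euclidean_space d) U)"

text \<open>
  The dimension of a subset of a real vector space is the largest dimension of a nonempty manifold
  contained in it. For a nonempty manifold this is the dimension of the manifold (lemma
  \<open>real_dim_manifold\<close> below). A semialgebraic set is a finite disjoint union of cells, each
  homeomorphic to an open cube, and for such a set this is the largest dimension of a cell, that
  is, the semialgebraic dimension. The value for the empty set is unspecified.
\<close>

definition real_dim :: "'a::euclidean_space set \<Rightarrow> nat" where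
  "real_dim S = (GREATEST d. \<exists>T. T \<subseteq> S \<and> T \<noteq> {} \<and> manifold_of_dim d T)"

lemma open_in_lower_Euclidean_space_empty:
  assumes W: "openin (Euclidean_space e) W" and sub: "W \<subseteq> topspace (Euclidean_space d)"
    and de: "d < e"
  shows "W = {}"
proof (rule ccontr)
  assume "W \<noteq> {}"
  then obtain y where y: "y \<in> W" by blast
  define g where "g = (\<lambda>t::real. (\<lambda>i. if i < e then (if i = d then t else y i) else 0))"
  have yd: "\<forall>i\<ge>d. y i = 0"
    using y sub by (auto simp: topspace_Euclidean_space)
  have "continuous_map euclideanreal (Euclidean_space e) g"
    unfolding g_def by (subst continuous_map_componentwise_Euclidean_space) auto
  then have "openin euclideanreal {t \<in> topspace euclideanreal. g t \<in> W}"
    using W by (rule openin_continuous_map_preimage)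
  then have op: "open {t. g t \<in> W}" by simp
  have g0: "g 0 = y" using yd de by (auto simp: g_def fun_eq_iff)
  have "t = 0" if "g t \<in> W" for t
  proof -
    have "g t d = 0" using that sub by (auto simp: topspace_Euclidean_space)
    then show ?thesis using de by (simp add: g_def)
  qed
  then have "{t. g t \<in> W} = {0}" using g0 y by auto
  then show False using op not_open_singleton[of "0::real"] by simp
qed

lemma Euclidean_space_injection_dim_le:
  assumes U: "openin (Euclidean_space e) U" "U \<noteq> {}"
    and f: "continuous_map (subtopology (Euclidean_space e) U) (Euclidean_space d) f" "inj_on f U"
  shows "e \<le> d"
proof (rule ccontr)
  assume "\<not> e \<le> d"
  then have de: "d < e" by simp
  have eq: "Euclidean_space d = subtopology (Euclidean_space e) (topspace (Euclidean_space d))"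
  proof -
    have "{x. \<forall>i\<ge>e. x i = 0} \<inter> {x. \<forall>i\<ge>d. x i = 0} = {x::nat \<Rightarrow> real. \<forall>i\<ge>d. x i = 0}"
      using de by auto
    then show ?thesis
      unfolding topspace_Euclidean_space by (simp add: Euclidean_space_def subtopology_subtopology)
  qed
  have f': "continuous_map (subtopology (Euclidean_space e) U) (Euclidean_space e) f"
    using f(1) eq by (metis continuous_map_in_subtopology)
  have "openin (Euclidean_space e) (f ` U)"
    using invariance_of_domain_Euclidean_space[OF U(1) f' f(2)] .
  moreover have "f ` U \<subseteq> topspace (Euclidean_space d)"
    using continuous_map_image_subset_topspace[OF f(1)] openin_subset[OF U(1)]
    by (simp add: Int_absorb1)
  ultimately show False
    using open_in_lower_Euclidean_space_empty de U(2) by blast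
qed

lemma manifold_dim_le:
  assumes T: "manifold_of_dim e T" "T \<noteq> {}" and S: "manifold_of_dim d S" and TS: "T \<subseteq> S"
  shows "e \<le> d"
proof -
  obtain x where x: "x \<in> T" using T(2) by blast
  obtain V U where V: "openin (top_of_set T) V" "x \<in> V" and U: "openin (Euclidean_space e) U"
    and VU: "top_of_set V homeomorphic_space subtopology (Euclidean_space e) U"
    using T(1) x unfolding manifold_of_dim_def by blast
  obtain V' U' where V': "openin (top_of_set S) V'" "x \<in> V'" and U': "openin (Euclidean_space d) U'"
    and VU': "top_of_set V' homeomorphic_space subtopology (Euclidean_space d) U'"
    using S x TS unfolding manifold_of_dim_def by blast
  obtain f g where fg: "homeomorphic_maps (top_of_set V) (subtopology (Euclidean_space e) U) f g"
    using VU unfolding homeomorphic_space_def by blast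
  obtain f' g' where fg': "homeomorphic_maps (top_of_set V') (subtopology (Euclidean_space d) U') f' g'"
    using VU' unfolding homeomorphic_space_def by blast
  have Utop: "topspace (subtopology (Euclidean_space e) U) = U"
    using openin_subset[OF U] by auto
  have cg: "continuous_map (subtopology (Euclidean_space e) U) (top_of_set V) g"
    and gf: "\<And>u. u \<in> U \<Longrightarrow> f (g u) = u" and fgx: "\<And>v. v \<in> V \<Longrightarrow> g (f v) = v"
    and fU: "\<And>v. v \<in> V \<Longrightarrow> f v \<in> U"
    using fg continuous_map_funspace[of "top_of_set V" "subtopology (Euclidean_space e) U" f] Utop
    unfolding homeomorphic_maps_def by (auto simp del: topspace_subtopology)
  have cf': "continuous_map (top_of_set V') (Euclidean_space d) f'"
    and gf': "\<And>v. v \<in> V' \<Longrightarrow> g' (f' v) = v"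
    using fg' unfolding homeomorphic_maps_def
    by (auto simp: continuous_map_in_subtopology)
  define W where "W = {u \<in> U. g u \<in> V'}"
  have VT: "V \<subseteq> T" using V(1) openin_imp_subset by blast
  obtain O' where O': "open O'" "V' = S \<inter> O'" using V'(1) by (auto simp: openin_open)
  have gV: "g u \<in> V" if "u \<in> U" for u
    using cg that Utop unfolding continuous_map_def by auto
  have "openin (subtopology (Euclidean_space e) U)
          {u \<in> topspace (subtopology (Euclidean_space e) U). g u \<in> V \<inter> O'}"
    using cg by (rule openin_continuous_map_preimage) (use O'(1) in auto)
  also have "{u \<in> topspace (subtopology (Euclidean_space e) U). g u \<in> V \<inter> O'} = W"
    unfolding Utop W_def using gV VT TS O'(2) by auto
  finally have W: "openin (Euclidean_space e) W"
    using U openin_trans_full by blast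
  have "f x \<in> W" using V(2) V'(2) fU fgx by (simp add: W_def)
  then have "W \<noteq> {}" by blast
  have WU: "W \<subseteq> U" by (auto simp: W_def)
  have "continuous_map (subtopology (Euclidean_space e) W) (top_of_set V) g"
    using continuous_map_from_subtopology_mono[OF cg WU] .
  then have "continuous_map (subtopology (Euclidean_space e) W) (top_of_set V') g"
    by (auto simp: continuous_map_in_subtopology W_def)
  then have "continuous_map (subtopology (Euclidean_space e) W) (Euclidean_space d) (f' \<circ> g)"
    using cf' by (rule continuous_map_compose)
  moreover have "inj_on (f' \<circ> g) W"
  proof (rule inj_onI)
    fix u w assume uw: "u \<in> W" "w \<in> W" "(f' \<circ> g) u = (f' \<circ> g) w"
    then have "u \<in> U" "w \<in> U" "g u \<in> V'" "g w \<in> V'" "f' (g u) = f' (g w)"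
      unfolding W_def by auto
    then show "u = w" using gf gf' by metis
  qed
  ultimately show "e \<le> d"
    using Euclidean_space_injection_dim_le[OF W \<open>W \<noteq> {}\<close>] by blast
qed

lemma real_dim_manifold:
  assumes "manifold_of_dim d S" "S \<noteq> {}"
  shows "real_dim S = d"
  unfolding real_dim_def
proof (rule Greatest_equality)
  show "\<exists>T. T \<subseteq> S \<and> T \<noteq> {} \<and> manifold_of_dim d T"
    using assms by (intro exI[of _ S]) simp
  show "e \<le> d" if "\<exists>T. T \<subseteq> S \<and> T \<noteq> {} \<and> manifold_of_dim e T" for e
    proof -
    obtain T where "T \<subseteq> S" "T \<noteq> {}" "manifold_of_dim e T"
      using \<open>\<exists>T. T \<subseteq> S \<and> T \<noteq> {} \<and> manifold_of_dim e T\<close> by blast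
    then show ?thesis by (intro manifold_dim_le[OF _ _ assms(1)])
  qed
qed


subsection \<open>Normal matrices with prescribed eigenvalue multiplicities\<close>

definition conj_transpose :: "complex^'n^'m \<Rightarrow> complex^'m^'n" where
  "conj_transpose A = map_matrix cnj (transpose A)"

definition normal_matrix :: "complex^'n^'n \<Rightarrow> bool" where
  "normal_matrix A \<longleftrightarrow> A ** conj_transpose A = conj_transpose A ** A"

definition eigenvalues :: "complex^'n^'n \<Rightarrow> complex set" where
  "eigenvalues A = {z. \<exists>v. v \<noteq> 0 \<and> A *v v = z *s v}"

definition charpoly :: "complex^'n^'n \<Rightarrow> complex poly" where
  "charpoly A = det (mat [:0, 1:] - map_matrix (\<lambda>a. [:a:]) A)"

definition multiplicity_of_eigenvalue :: "complex^'n^'n \<Rightarrow> complex \<Rightarrow> nat" where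
  "multiplicity_of_eigenvalue A z = Polynomial.order z (charpoly A)"

text \<open>
  Since \<open>e\<close> is an arbitrary enumeration of the eigenvalues, the set depends only on the multiset
  of the numbers \<open>k 1, \<dots>, k I\<close>.
\<close>

definition normal_with_mults :: "nat \<Rightarrow> (nat \<Rightarrow> nat) \<Rightarrow> (complex^'n^'n) set" where
  "normal_with_mults I k =
     {A. normal_matrix A \<and>
         (\<exists>e. bij_betw e {1..I} (eigenvalues A) \<and>
              (\<forall>i\<in>{1..I}. multiplicity_of_eigenvalue A (e i) = k i))}"

end

(*
  Conjugating a point of N(k_1, ..., k_I) to D = diag d, put one index pair (i, j) for each
  unordered pair with d i \<noteq> d j into L and choose a representative of each fibre of d. The
  entries of a matrix at L and at the representatives on the diagonal lie in a coordinate space V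
  of real dimension n^2 - sum k_i^2 + 2 I.

  Upper bound: near D these entries determine a normal matrix with I eigenvalues. For two such
  matrices a, b at distance at most \<epsilon> from D with equal entries, put \<Delta> = a - b. Linearising
  a a* = a* a at D bounds the remaining entries of \<Delta> outside the diagonal blocks by
  O(\<epsilon> |\<Delta>|). If P and Q are spectral projections of a and b for eigenvalues \<alpha> and \<beta> near the
  same z, then Q \<Delta> P = (\<alpha> - \<beta>) Q P; both P and Q are within O(\<epsilon>) of the block projection of D,
  so the vanishing of one diagonal entry of the block makes \<alpha> - \<beta>, and hence the whole block of
  \<Delta>, O(\<epsilon> |\<Delta>|). So \<Delta> = 0, and invariance of domain bounds the dimension.

  Lower bound: V also parametrises pairs of a skew-Hermitian X with zero diagonal blocks and of a
  diagonal matrix near D with the same fibres. Conjugating the latter by the Cayley transform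
  (1 - X)(1 + X)^-1 is continuous and injective near 0, hence a homeomorphism onto its image.
*)
theory Submission
  imports Defs "HOL-Computational_Algebra.Fundamental_Theorem_Algebra"
begin

subsection \<open>Dimension via local injections\<close>

text \<open>Invariance of domain does the work: a chart of \<open>T\<close> at \<open>x\<close>, cut
  down to the preimage of \<open>N\<close> and followed by \<open>f\<close> and by a homeomorphism
  of \<open>span B\<close> with Euclidean space, is a continuous injection between Euclidean spaces.
  One point \<open>x\<close> suffices, since \<open>e\<close> is the dimension of every chart of
  \<open>T\<close>.\<close>

lemma manifold_dim_le_local_injection:
  fixes T :: "'a::euclidean_space set" and B :: "'b::euclidean_space set"
  assumes T: "manifold_of_dim e T" "x \<in> T"
    and B: "independent B" "pairwise orthogonal B" "\<And>u. u \<in> B \<Longrightarrow> norm u = 1"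
    and N: "open N" "x \<in> N"
    and f: "continuous_on (T \<inter> N) f" "inj_on f (T \<inter> N)" "f ` (T \<inter> N) \<subseteq> span B"
  shows "e \<le> card B"
proof -
  obtain h k where hk: "homeomorphic_maps (Euclidean_space (card B)) (top_of_set (span B)) h k"
    using homeomorphic_maps_Euclidean_space_euclidean_gen[OF B(1,2) refl B(3)] by metis
  obtain V U where V: "openin (top_of_set T) V" "x \<in> V" and U: "openin (Euclidean_space e) U"
    and VU: "top_of_set V homeomorphic_space subtopology (Euclidean_space e) U"
    using T unfolding manifold_of_dim_def by blast
  obtain p q where pq: "homeomorphic_maps (top_of_set V) (subtopology (Euclidean_space e) U) p q"
    using VU unfolding homeomorphic_space_def by blast
  have Utop: "topspace (subtopology (Euclidean_space e) U) = U"
    using openin_subset[OF U] by auto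
  have cq: "continuous_map (subtopology (Euclidean_space e) U) (top_of_set V) q"
    and pq1: "\<And>u. u \<in> U \<Longrightarrow> p (q u) = u" and qp: "\<And>v. v \<in> V \<Longrightarrow> q (p v) = v"
    and pU: "\<And>v. v \<in> V \<Longrightarrow> p v \<in> U"
    using pq continuous_map_funspace[of "top_of_set V" "subtopology (Euclidean_space e) U" p] Utop
    unfolding homeomorphic_maps_def by (auto simp del: topspace_subtopology)
  have qV: "q u \<in> V" if "u \<in> U" for u
    using cq that Utop unfolding continuous_map_def by auto
  have VT: "V \<subseteq> T" using V(1) openin_imp_subset by blast
  \<comment> \<open>The part of the chart domain that lands in \<open>N\<close>. It is open in all
    of Euclidean space because \<open>U\<close> is.\<close>
  define W where "W = {u \<in> U. q u \<in> N}"
  have "openin (subtopology (Euclidean_space e) U)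
          {u \<in> topspace (subtopology (Euclidean_space e) U). q u \<in> V \<inter> N}"
    using cq by (rule openin_continuous_map_preimage) (use N(1) in auto)
  also have "{u \<in> topspace (subtopology (Euclidean_space e) U). q u \<in> V \<inter> N} = W"
    unfolding Utop W_def using qV by auto
  finally have W: "openin (Euclidean_space e) W"
    using U openin_trans_full by blast
  have "p x \<in> W" using V(2) N(2) pU qp by (simp add: W_def)
  then have Wne: "W \<noteq> {}" by blast
  have WU: "W \<subseteq> U" by (auto simp: W_def)
  have qW: "q ` W \<subseteq> T \<inter> N" using qV VT by (auto simp: W_def)
  have cqW: "continuous_map (subtopology (Euclidean_space e) W) (top_of_set (T \<inter> N)) q"
    using continuous_map_from_subtopology_mono[OF cq WU] qW
    by (auto simp: continuous_map_in_subtopology)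
  have cf: "continuous_map (top_of_set (T \<inter> N)) (top_of_set (span B)) f"
    using f by auto
  have ck: "continuous_map (top_of_set (span B)) (Euclidean_space (card B)) k"
    and hk1: "\<And>v. v \<in> span B \<Longrightarrow> h (k v) = v"
    using hk unfolding homeomorphic_maps_def by auto
  have "continuous_map (subtopology (Euclidean_space e) W) (Euclidean_space (card B)) (k \<circ> (f \<circ> q))"
    by (intro continuous_map_compose[OF _ ck] continuous_map_compose[OF cqW cf])
  moreover have "inj_on (k \<circ> (f \<circ> q)) W"
  proof (rule inj_onI)
    fix u w assume uw: "u \<in> W" "w \<in> W" "(k \<circ> (f \<circ> q)) u = (k \<circ> (f \<circ> q)) w"
    then have *: "q u \<in> T \<inter> N" "q w \<in> T \<inter> N" using qW by auto
    then have "f (q u) \<in> span B" "f (q w) \<in> span B" using f(3) by auto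
    then have "f (q u) = f (q w)" using uw(3) hk1 by (metis comp_apply)
    then have "q u = q w" using f(2) * by (meson inj_onD)
    then show "u = w" using uw(1,2) WU pq1 by (metis subsetD)
  qed
  ultimately show ?thesis
    using Euclidean_space_injection_dim_le[OF W Wne] by blast
qed

text \<open>A continuous injection on a compact set is a homeomorphism onto its image, so no inverse
  has to be exhibited. The closed ball supplies the compactness; the open ball inside it is the
  chart domain.\<close>

lemma manifold_of_dim_injective_image:
  fixes B :: "'b::euclidean_space set" and f :: "'b \<Rightarrow> 'a::euclidean_space"
  assumes B: "independent B" "pairwise orthogonal B" "\<And>u. u \<in> B \<Longrightarrow> norm u = 1"
    and f: "continuous_on (cball 0 r \<inter> span B) f" "inj_on f (cball 0 r \<inter> span B)"
  shows "manifold_of_dim (card B) (f ` (ball 0 r \<inter> span B))"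
proof -
  obtain h k where hk: "homeomorphic_maps (Euclidean_space (card B)) (top_of_set (span B)) h k"
    using homeomorphic_maps_Euclidean_space_euclidean_gen[OF B(1,2) refl B(3)] by metis
  define W where "W = ball 0 r \<inter> span B"
  define U where "U = {x \<in> topspace (Euclidean_space (card B)). h x \<in> W}"
  have ch: "continuous_map (Euclidean_space (card B)) (top_of_set (span B)) h"
    using hk unfolding homeomorphic_maps_def by auto
  have Wopen: "openin (top_of_set (span B)) W"
    unfolding W_def by (metis Int_commute open_ball openin_open_Int)
  have U: "openin (Euclidean_space (card B)) U"
    unfolding U_def by (rule openin_continuous_map_preimage[OF ch Wopen])
  have "h ` (topspace (Euclidean_space (card B)) \<inter> U) = topspace (top_of_set (span B)) \<inter> W"
  proof -
    have "h (k y) = y" "k y \<in> topspace (Euclidean_space (card B))" if "y \<in> span B" for y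
      using hk that continuous_map_funspace[of "top_of_set (span B)" "Euclidean_space (card B)" k]
      unfolding homeomorphic_maps_def by auto
    then show ?thesis unfolding U_def W_def by (force simp: image_iff)
  qed
  from homeomorphic_maps_subtopologies[OF hk this]
  have "subtopology (top_of_set (span B)) W homeomorphic_space subtopology (Euclidean_space (card B)) U"
    using homeomorphic_maps_imp_homeomorphic_space homeomorphic_space_sym by blast
  moreover have "subtopology (top_of_set (span B)) W = top_of_set W"
    by (simp add: subtopology_subtopology W_def inf_commute)
  moreover have "top_of_set (f ` W) homeomorphic_space top_of_set W"
  proof -
    have "compact (cball 0 r \<inter> span B)"
      by (simp add: compact_Int_closed closed_span)
    then obtain g where "homeomorphism (cball 0 r \<inter> span B) (f ` (cball 0 r \<inter> span B)) f g"
      using homeomorphism_compact[OF _ f(1) refl f(2)] by blast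
    then have "homeomorphism W (f ` W) f g"
      by (rule homeomorphism_of_subsets) (auto simp: W_def)
    then have "homeomorphic_maps (top_of_set W) (top_of_set (f ` W)) f g"
      unfolding homeomorphism_def homeomorphic_maps_def by auto
    then show ?thesis
      using homeomorphic_maps_imp_homeomorphic_space homeomorphic_space_sym by blast
  qed
  ultimately have "top_of_set (f ` W) homeomorphic_space subtopology (Euclidean_space (card B)) U"
    using homeomorphic_space_trans by metis
  then show ?thesis
    unfolding manifold_of_dim_def W_def[symmetric]
    using U openin_subtopology_self by blast
qed

text \<open>Computes the dimension without proving that \<open>S\<close> itself is a manifold: one
  manifold inside \<open>S\<close> gives the lower bound, and a bound on all of them gives the upper
  one.\<close>

lemma real_dim_eqI:
  fixes S :: "'a::euclidean_space set"
  assumes "T \<subseteq> S" "T \<noteq> {}" "manifold_of_dim d T"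
    and "\<And>T e. T \<subseteq> S \<Longrightarrow> T \<noteq> {} \<Longrightarrow> manifold_of_dim e T \<Longrightarrow> e \<le> d"
  shows "real_dim S = d"
  unfolding real_dim_def by (rule Greatest_equality) (use assms in blast)+

subsection \<open>Adjoints and unitary matrices\<close>

lemma matrix_mult_distribs:
  fixes A B :: "'a::ring_1^'n^'m" and C D :: "'a^'p^'n"
  shows "(A + B) ** C = A ** C + B ** C" "A ** (C + D) = A ** C + A ** D"
    "(A - B) ** C = A ** C - B ** C" "A ** (C - D) = A ** C - A ** D"
  by (simp_all add: vec_eq_iff matrix_matrix_mult_def algebra_simps sum.distrib sum_subtractf)

text \<open>The norm on this type is the Frobenius norm. Cauchy-Schwarz bounds each entry of the
  product by (norm of a row of \<open>A\<close>) times (norm of a column of \<open>B\<close>), and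
  the squares of these bounds sum to the square of the right-hand side.\<close>

lemma norm_matrix_mult_le:
  fixes A :: "complex^'n^'n" and B :: "complex^'n^'n"
  shows "norm (A ** B) \<le> norm A * norm B"
proof -
  define a where "a i = norm (A $ i)" for i
  define b where "b j = L2_set (\<lambda>k. norm (B $ k $ j)) UNIV" for j
  have entry: "norm ((A ** B) $ i $ j) \<le> a i * b j" for i j
  proof -
    have "norm ((A ** B) $ i $ j) \<le> (\<Sum>k\<in>UNIV. norm (A $ i $ k) * norm (B $ k $ j))"
      unfolding matrix_matrix_mult_def by (simp add: norm_mult[symmetric] norm_sum)
    also have "\<dots> \<le> a i * b j"
      using L2_set_mult_ineq[of "\<lambda>k. norm (A $ i $ k)" "\<lambda>k. norm (B $ k $ j)" UNIV]
      unfolding a_def b_def by (simp add: norm_vec_def)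
    finally show ?thesis .
  qed
  have nonneg: "0 \<le> a i" "0 \<le> b j" for i j
    by (auto simp: a_def b_def L2_set_nonneg)
  have row: "norm ((A ** B) $ i) \<le> a i * L2_set b UNIV" for i
  proof -
    have "norm ((A ** B) $ i) \<le> L2_set (\<lambda>j. a i * b j) UNIV"
      unfolding norm_vec_def by (intro L2_set_mono entry) auto
    then show ?thesis using nonneg by (simp add: L2_set_right_distrib)
  qed
  have "L2_set b UNIV = norm B"
  proof -
    have "(\<Sum>j\<in>UNIV. (b j)\<^sup>2) = (\<Sum>k\<in>UNIV. (norm (B $ k))\<^sup>2)"
      unfolding b_def norm_vec_def L2_set_def
      by (simp add: sum_nonneg) (rule sum.swap)
    then show ?thesis by (simp add: norm_vec_def[of B] L2_set_def)
  qed
  then have "norm (A ** B) \<le> L2_set (\<lambda>i. a i * norm B) UNIV"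
    unfolding norm_vec_def[of "A ** B"] using row by (intro L2_set_mono) auto
  also have "\<dots> = norm A * norm B"
    unfolding norm_vec_def[of A] a_def by (simp add: L2_set_left_distrib)
  finally show ?thesis .
qed

lemma norm_entry_le: "norm (A $ i $ j) \<le> norm (A :: complex^'n^'m)"
  using Finite_Cartesian_Product.norm_nth_le[of "A $ i" j] Finite_Cartesian_Product.norm_nth_le[of A i] by linarith

lemma norm_matrix_le_sum:
  "norm (A :: complex^'n^'m) \<le> (\<Sum>i\<in>UNIV. \<Sum>j\<in>UNIV. norm (A $ i $ j))"
proof -
  have "norm A \<le> (\<Sum>i\<in>UNIV. norm (A $ i))"
    unfolding norm_vec_def[of A] by (rule L2_set_le_sum) simp
  also have "\<dots> \<le> (\<Sum>i\<in>UNIV. \<Sum>j\<in>UNIV. norm (A $ i $ j))"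
    unfolding norm_vec_def[of "A $ _"] by (intro sum_mono L2_set_le_sum) simp
  finally show ?thesis .
qed

text \<open>The origin of the constant \<open>K\<close>, the square of the matrix size, in the later
  perturbation estimates.\<close>

lemma norm_matrix_le_entries:
  fixes A :: "complex^'n^'n"
  assumes "\<And>i j. norm (A $ i $ j) \<le> c"
  shows "norm A \<le> (real CARD('n))\<^sup>2 * c"
proof -
  have "(\<Sum>i\<in>UNIV. \<Sum>j\<in>UNIV. norm (A $ i $ j)) \<le> (\<Sum>i\<in>(UNIV::'n set). \<Sum>j\<in>(UNIV::'n set). c)"
    by (intro sum_mono assms)
  also have "\<dots> = (real CARD('n))\<^sup>2 * c" by (simp add: power2_eq_square)
  finally show ?thesis using norm_matrix_le_sum[of A] by linarith
qed

lemma conj_transpose_nth [simp]: "conj_transpose A $ i $ j = cnj (A $ j $ i)"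
  by (simp add: conj_transpose_def transpose_def)

lemma conj_transpose_conj_transpose [simp]: "conj_transpose (conj_transpose A) = A"
  by (simp add: vec_eq_iff)

lemma conj_transpose_matrix_mult: "conj_transpose (A ** B) = conj_transpose B ** conj_transpose A"
  by (simp add: vec_eq_iff matrix_matrix_mult_def mult.commute)

lemma conj_transpose_add: "conj_transpose (A + B) = conj_transpose A + conj_transpose B"
  by (simp add: vec_eq_iff)

lemma conj_transpose_diff: "conj_transpose (A - B) = conj_transpose A - conj_transpose B"
  by (simp add: vec_eq_iff)

lemma conj_transpose_mat1 [simp]: "conj_transpose (mat 1) = mat 1"
  by (simp add: vec_eq_iff mat_def)

lemma norm_conj_transpose [simp]: "norm (conj_transpose A) = norm (A :: complex^'n^'n)"
proof -
  have "(\<Sum>i\<in>UNIV. \<Sum>j\<in>UNIV. (norm (A $ j $ i))\<^sup>2) = (\<Sum>i\<in>UNIV. \<Sum>j\<in>UNIV. (norm (A $ i $ j))\<^sup>2)"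
    by (rule sum.swap)
  then show ?thesis
    unfolding norm_vec_def L2_set_def by (simp add: sum_nonneg)
qed

definition unitary_matrix :: "complex^'n^'n \<Rightarrow> bool" where
  "unitary_matrix U \<longleftrightarrow> conj_transpose U ** U = mat 1"

definition diag_matrix :: "('n \<Rightarrow> 'a::zero) \<Rightarrow> 'a^'n^'n" where
  "diag_matrix d = (\<chi> i j. if i = j then d i else 0)"

lemma diag_matrix_nth: "diag_matrix d $ i $ j = (if i = j then d i else 0)"
  by (simp add: diag_matrix_def)

lemma unitary_matrixD:
  assumes "unitary_matrix U"
  shows "conj_transpose U ** U = mat 1" "U ** conj_transpose U = mat 1"
  using assms matrix_left_right_inverse unfolding unitary_matrix_def by blast+

lemma unitary_matrix_mult:
  "unitary_matrix U \<Longrightarrow> unitary_matrix V \<Longrightarrow> unitary_matrix (U ** V)"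
  unfolding unitary_matrix_def conj_transpose_matrix_mult
  by (metis matrix_mul_assoc matrix_mul_rid)

lemma unitary_matrix_conj_transpose: "unitary_matrix U \<Longrightarrow> unitary_matrix (conj_transpose U)"
  by (simp add: unitary_matrix_def unitary_matrixD)

lemma diag_matrix_mult_left [simp]:
  "(diag_matrix d ** A) $ i $ j = d i * (A $ i $ j)" for A :: "'a::semiring_1^'m^'n"
proof -
  have "(\<Sum>k\<in>UNIV. (if i = k then d i else 0) * A $ k $ j)
      = (\<Sum>k\<in>UNIV. if k = i then d i * A $ i $ j else 0)"
    by (intro sum.cong) auto
  then show ?thesis by (simp add: matrix_matrix_mult_def diag_matrix_def)
qed

lemma diag_matrix_mult_right [simp]:
  "(A ** diag_matrix d) $ i $ j = A $ i $ j * d j" for A :: "'a::semiring_1^'n^'m"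
proof -
  have "(\<Sum>k\<in>UNIV. A $ i $ k * (if k = j then d k else 0))
      = (\<Sum>k\<in>UNIV. if k = j then A $ i $ j * d j else 0)"
    by (intro sum.cong) auto
  then show ?thesis by (simp add: matrix_matrix_mult_def diag_matrix_def)
qed

lemma diag_matrix_mult: "diag_matrix c ** diag_matrix d = diag_matrix (\<lambda>i. c i * d i)"
  for c :: "'n::finite \<Rightarrow> 'a::semiring_1"
  by (simp add: vec_eq_iff) (simp add: diag_matrix_nth)

lemma conj_transpose_diag_matrix: "conj_transpose (diag_matrix d) = diag_matrix (\<lambda>i. cnj (d i))"
  by (simp add: vec_eq_iff diag_matrix_nth)

lemma unitary_matrix_row_sum:
  assumes "unitary_matrix (U :: complex^'n^'n)"
  shows "(\<Sum>k\<in>UNIV. (norm (U $ i $ k))\<^sup>2) = 1"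
proof -
  have "(U ** conj_transpose U) $ i $ i = 1"
    using unitary_matrixD(2)[OF assms] by (simp add: mat_def)
  then have "complex_of_real (\<Sum>k\<in>UNIV. (norm (U $ i $ k))\<^sup>2) = 1"
    by (simp add: matrix_matrix_mult_def complex_norm_square del: of_real_power)
  then show ?thesis using of_real_eq_1_iff by blast
qed

lemma unitary_matrix_entry_le:
  assumes "unitary_matrix (U :: complex^'n^'n)"
  shows "norm (U $ i $ j) \<le> 1"
proof -
  have "(norm (U $ i $ j))\<^sup>2 \<le> (\<Sum>k\<in>UNIV. (norm (U $ i $ k))\<^sup>2)"
    by (rule member_le_sum) auto
  then show ?thesis using unitary_matrix_row_sum[OF assms] by (simp add: power_le_one_iff)
qed

lemma norm_unitary_matrix_le:
  "unitary_matrix (U :: complex^'n^'n) \<Longrightarrow> norm U \<le> (real CARD('n))\<^sup>2"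
  using norm_matrix_le_entries[of U 1] unitary_matrix_entry_le[of U] by simp

text \<open>The squares along a row sum to 1 and are at most the entries themselves, so the entries
  cannot all be below 1/n. This attaches to each coordinate \<open>i\<close> a column, later an
  eigenvector, whose component at \<open>i\<close> is bounded away from 0.\<close>

lemma unitary_matrix_row_large_entry:
  assumes "unitary_matrix (U :: complex^'n^'n)"
  obtains k where "norm (U $ i $ k) \<ge> 1 / real CARD('n)"
proof -
  let ?n = "real CARD('n)"
  have n: "?n \<ge> 1" by (simp add: Suc_leI)
  have "\<exists>k. norm (U $ i $ k) \<ge> 1 / ?n"
  proof (rule ccontr)
    assume "\<nexists>k. norm (U $ i $ k) \<ge> 1 / ?n"
    then have lt: "norm (U $ i $ k) < 1 / ?n" for k by (meson not_le)
    have "(norm (U $ i $ k))\<^sup>2 < 1 / ?n" for k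
    proof -
      have "(norm (U $ i $ k))\<^sup>2 \<le> norm (U $ i $ k) * 1"
        unfolding power2_eq_square
        by (intro mult_left_mono unitary_matrix_entry_le assms) auto
      then show ?thesis using lt[of k] by simp
    qed
    then have "(\<Sum>k\<in>UNIV. (norm (U $ i $ k))\<^sup>2) < (\<Sum>k\<in>(UNIV::'n set). 1 / ?n)"
      by (intro sum_strict_mono) auto
    then show False using unitary_matrix_row_sum[OF assms, of i] by simp
  qed
  then show ?thesis using that by blast
qed

section \<open>Characteristic polynomial and spectrum of a unitary conjugate of a diagonal
  matrix\<close>

definition poly_matrix :: "complex^'n^'n \<Rightarrow> complex poly^'n^'n" where
  "poly_matrix A = map_matrix (\<lambda>a. [:a:]) A"

lemma poly_matrix_mult:
  fixes A B :: "complex^'n^'n"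
  shows "poly_matrix (A ** B) = poly_matrix A ** poly_matrix B"
proof -
  have "[:\<Sum>k\<in>K. f k:] = (\<Sum>k\<in>K. [:f k:])" for K :: "'n set" and f :: "'n \<Rightarrow> complex"
  proof (induction K rule: infinite_finite_induct)
    case (insert x K)
    have "[:f x + sum f K:] = [:f x:] + [:sum f K:]" by simp
    then show ?case using insert by (simp del: add_pCons)
  qed auto
  then show ?thesis
    by (simp add: vec_eq_iff poly_matrix_def matrix_matrix_mult_def mult.commute)
qed

text \<open>Read as matrices of constant polynomials, \<open>U\<close> and its adjoint remain
  inverse to each other, and the scalar matrix of the indeterminate is central. The characteristic
  matrix is therefore conjugate to a diagonal one, and the outer determinants cancel.\<close>

lemma charpoly_unitary_conj:
  fixes U :: "complex^'n^'n"
  assumes U: "unitary_matrix U"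
  shows "charpoly (U ** diag_matrix d ** conj_transpose U) = (\<Prod>i\<in>UNIV. [:- d i, 1:])"
proof -
  have UU: "poly_matrix U ** poly_matrix (conj_transpose U) = mat 1"
    unfolding poly_matrix_mult[symmetric] unitary_matrixD(2)[OF U]
    by (simp add: poly_matrix_def mat_def vec_eq_iff)
  have x: "mat [:0,1:] ** M = M ** mat [:0, 1:]" for M :: "complex poly^'n^'n"
    unfolding mat_def diag_matrix_def[symmetric] by (simp add: vec_eq_iff mult.commute)
  have "mat [:0, 1:] - poly_matrix (U ** diag_matrix d ** conj_transpose U)
     = poly_matrix U ** (mat [:0, 1:] - poly_matrix (diag_matrix d)) ** poly_matrix (conj_transpose U)"
    unfolding poly_matrix_mult matrix_mult_distribs
    by (simp add: x[symmetric] matrix_mul_assoc[symmetric] UU)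
  moreover have "det (poly_matrix U) * det (poly_matrix (conj_transpose U)) = 1"
    using UU det_mul det_I by metis
  ultimately have "charpoly (U ** diag_matrix d ** conj_transpose U)
      = det (mat [:0, 1:] - poly_matrix (diag_matrix d))"
    unfolding charpoly_def poly_matrix_def[symmetric]
    by (simp add: det_mul mult.assoc mult.left_commute[of "det (poly_matrix U)"])
  also have "mat [:0, 1:] - poly_matrix (diag_matrix d) = diag_matrix (\<lambda>i. [:- d i, 1:])"
    by (simp add: vec_eq_iff mat_def poly_matrix_def diag_matrix_nth)
  also have "det \<dots> = (\<Prod>i\<in>UNIV. [:- d i, 1:])"
    by (subst det_diagonal) (auto simp: diag_matrix_nth)
  finally show ?thesis .
qed

lemma order_prod_linear:
  fixes d :: "'i \<Rightarrow> complex"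
  assumes "finite K"
  shows "Polynomial.order z (\<Prod>i\<in>K. [:- d i, 1:]) = card {i\<in>K. d i = z}"
  using assms
proof induction
  case (insert i K)
  have "[:- d i, 1:] * (\<Prod>i\<in>K. [:- d i, 1:]) \<noteq> 0"
    using insert.hyps(1) by (simp del: mult_pCons_left)
  then have "Polynomial.order z (\<Prod>i\<in>insert i K. [:- d i, 1:])
      = Polynomial.order z [:- d i, 1:] + card {i\<in>K. d i = z}"
    using insert by (simp add: order_mult del: mult_pCons_left)
  moreover have "Polynomial.order z [:- d i, 1:] = (if d i = z then 1 else 0)"
    using order_power_n_n[of z 1] order_0I[of "[:- d i, 1:]" z] by auto
  moreover have "{j \<in> insert i K. d j = z} = (if d i = z then insert i {j\<in>K. d j = z} else {j\<in>K. d j = z})"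
    by auto
  ultimately show ?case using insert.hyps by simp
qed simp

lemma multiplicity_unitary_conj:
  fixes U :: "complex^'n^'n"
  assumes "unitary_matrix U"
  shows "multiplicity_of_eigenvalue (U ** diag_matrix d ** conj_transpose U) z = card {i. d i = z}"
  unfolding multiplicity_of_eigenvalue_def charpoly_unitary_conj[OF assms]
  by (subst order_prod_linear) auto

lemma diag_matrix_mult_vec: "(diag_matrix d *v v) $ i = d i * v $ i" for v :: "'a::semiring_1^'n"
proof -
  have "(\<Sum>k\<in>UNIV. (if i = k then d i else 0) * v $ k) = (\<Sum>k\<in>UNIV. if k = i then d i * v $ i else 0)"
    by (intro sum.cong) auto
  then show ?thesis by (simp add: matrix_vector_mult_def diag_matrix_def)
qed

lemma eigenvalues_unitary_conj:
  fixes U :: "complex^'n^'n"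
  assumes U: "unitary_matrix U"
  shows "eigenvalues (U ** diag_matrix d ** conj_transpose U) = range d"
proof (intro equalityI subsetI)
  fix z assume "z \<in> eigenvalues (U ** diag_matrix d ** conj_transpose U)"
  then obtain v where v: "v \<noteq> 0" "(U ** diag_matrix d ** conj_transpose U) *v v = z *s v"
    unfolding eigenvalues_def by blast
  \<comment> \<open>In these coordinates the matrix is diagonal, so any nonzero coordinate of
    \<open>w\<close> identifies the eigenvalue.\<close>
  define w where "w = conj_transpose U *v v"
  have "U *v w = v" unfolding w_def by (simp add: matrix_vector_mul_assoc unitary_matrixD(2)[OF U])
  then have "w \<noteq> 0" using v(1) by auto
  then obtain i where i: "w $ i \<noteq> 0" by (auto simp: vec_eq_iff)
  have "conj_transpose U *v ((U ** diag_matrix d ** conj_transpose U) *v v) = diag_matrix d *v w"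
    unfolding w_def matrix_vector_mul_assoc matrix_mul_assoc unitary_matrixD(1)[OF U] by simp
  then have "diag_matrix d *v w = z *s w"
    unfolding v(2) w_def by (simp add: vector_scalar_commute)
  then have "d i * w $ i = z * w $ i"
    by (metis diag_matrix_mult_vec vector_smult_component)
  then show "z \<in> range d" using i by auto
next
  fix z assume "z \<in> range d"
  then obtain i where i: "z = d i" by blast
  define v where "v = U *v axis i 1"
  have cv: "conj_transpose U *v v = axis i 1"
    unfolding v_def by (simp add: matrix_vector_mul_assoc unitary_matrixD(1)[OF U])
  then have "v \<noteq> 0" by (auto simp: axis_eq_0_iff)
  moreover have "diag_matrix d *v axis i 1 = z *s axis i 1"
    by (simp add: vec_eq_iff diag_matrix_mult_vec) (simp add: axis_def i)
  then have "(U ** diag_matrix d ** conj_transpose U) *v v = z *s v"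
    by (simp add: matrix_vector_mul_assoc[symmetric] cv vector_scalar_commute) (simp add: v_def)
  ultimately show "z \<in> eigenvalues (U ** diag_matrix d ** conj_transpose U)"
    unfolding eigenvalues_def by blast
qed

lemma unitary_conj_mult:
  assumes "unitary_matrix U"
  shows "(U ** D ** conj_transpose U) ** (U ** E ** conj_transpose U) = U ** (D ** E) ** conj_transpose U"
proof -
  have "(U ** D ** conj_transpose U) ** (U ** E ** conj_transpose U)
      = U ** D ** (conj_transpose U ** U) ** E ** conj_transpose U"
    by (simp only: matrix_mul_assoc)
  then show ?thesis by (simp add: unitary_matrixD(1)[OF assms] matrix_mul_assoc)
qed

lemma normal_unitary_conj:
  fixes U :: "complex^'n^'n"
  assumes U: "unitary_matrix U"
  shows "normal_matrix (U ** diag_matrix d ** conj_transpose U)"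
proof -
  have "conj_transpose (U ** diag_matrix d ** conj_transpose U)
      = U ** diag_matrix (\<lambda>i. cnj (d i)) ** conj_transpose U"
    by (simp add: conj_transpose_matrix_mult conj_transpose_diag_matrix matrix_mul_assoc)
  then show ?thesis
    unfolding normal_matrix_def by (simp add: unitary_conj_mult[OF U] diag_matrix_mult mult.commute)
qed

text \<open>Turns membership into a condition on the fibres of \<open>d\<close>: algebraic
  multiplicities of the conjugate are fibre cardinalities.\<close>

lemma unitary_conj_in_normal_with_mults_iff:
  fixes U :: "complex^'n^'n"
  assumes "unitary_matrix U"
  shows "U ** diag_matrix d ** conj_transpose U \<in> normal_with_mults I k \<longleftrightarrow>
    (\<exists>e. bij_betw e {1..I} (range d) \<and> (\<forall>i\<in>{1..I}. card {j. d j = e i} = k i))"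
  by (simp add: normal_with_mults_def normal_unitary_conj eigenvalues_unitary_conj
      multiplicity_unitary_conj assms)

subsection \<open>The spectral theorem\<close>

text \<open>The standard Hermitian inner product, conjugate linear in the first argument; the real
  inner product \<open>\<bullet>\<close> of the same vectors is its real part.\<close>

definition cinner :: "complex^'n \<Rightarrow> complex^'n \<Rightarrow> complex" where
  "cinner u v = (\<Sum>i\<in>UNIV. cnj (u $ i) * v $ i)"

lemma cinner_add_right: "cinner u (v + w) = cinner u v + cinner u w"
  by (simp add: cinner_def algebra_simps sum.distrib)

lemma cinner_diff_right: "cinner u (v - w) = cinner u v - cinner u w"
  by (simp add: cinner_def algebra_simps sum_subtractf)

lemma cinner_scale_right: "cinner u (c *s v) = c * cinner u v"
  by (simp add: cinner_def sum_distrib_left mult_ac)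

lemma cinner_scale_left: "cinner (c *s u) v = cnj c * cinner u v"
  by (simp add: cinner_def sum_distrib_left mult_ac)

lemma cinner_zero_right [simp]: "cinner u 0 = 0"
  by (simp add: cinner_def)

lemma cinner_sum_right: "cinner u (\<Sum>i\<in>K. f i) = (\<Sum>i\<in>K. cinner u (f i))"
  by (induction K rule: infinite_finite_induct) (auto simp: cinner_add_right)

lemma cinner_commute: "cinner v u = cnj (cinner u v)"
  by (simp add: cinner_def mult.commute)

lemma cinner_self: "cinner v v = of_real ((norm v)\<^sup>2)"
  by (simp add: cinner_def norm_vec_def L2_set_def sum_nonneg complex_norm_square mult.commute
      del: of_real_power)

lemma cinner_mult_vec: "cinner u (A *v v) = cinner (conj_transpose A *v u) v"
proof -
  have "cinner u (A *v v) = (\<Sum>i\<in>UNIV. \<Sum>j\<in>UNIV. cnj (u $ i) * (A $ i $ j * v $ j))"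
    by (simp add: cinner_def matrix_vector_mult_def sum_distrib_left)
  also have "\<dots> = (\<Sum>j\<in>UNIV. \<Sum>i\<in>UNIV. cnj (u $ i) * (A $ i $ j * v $ j))"
    by (rule sum.swap)
  also have "\<dots> = cinner (conj_transpose A *v u) v"
    by (simp add: cinner_def matrix_vector_mult_def sum_distrib_right sum_distrib_left mult_ac)
  finally show ?thesis .
qed

definition orthonormal :: "(complex^'n) set \<Rightarrow> bool" where
  "orthonormal B \<longleftrightarrow> (\<forall>u\<in>B. \<forall>v\<in>B. cinner u v = (if u = v then 1 else 0))"

lemma orthonormal_independent:
  fixes B :: "(complex^'n) set"
  assumes B: "orthonormal B"
  shows "vec.independent B"
proof
  assume "vec.dependent B"
  then obtain t u w where t: "finite t" "t \<subseteq> B" "(\<Sum>v\<in>t. u v *s v) = 0" "w \<in> t" "u w \<noteq> 0"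
    unfolding vec.dependent_explicit by blast
  have "0 = cinner w (\<Sum>v\<in>t. u v *s v)" using t by simp
  also have "\<dots> = (\<Sum>v\<in>t. u v * cinner w v)"
    by (simp add: cinner_sum_right cinner_scale_right)
  also have "\<dots> = (\<Sum>v\<in>t. if v = w then u w else 0)"
    using B t unfolding orthonormal_def by (intro sum.cong) (auto simp: subset_iff)
  also have "\<dots> = u w" using t by simp
  finally show False using t by simp
qed

lemma orthonormal_card:
  fixes B :: "(complex^'n) set"
  assumes "orthonormal B"
  shows "finite B" "card B \<le> CARD('n)"
  using vec.independent_bound_general[OF orthonormal_independent[OF assms]] 
  by (auto simp: intro: order_trans[OF _ dim_subset_UNIV_cart_gen])

text \<open>One Gram-Schmidt step, applied to a vector outside the span of \<open>B\<close>, which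
  exists by counting dimensions.\<close>

lemma exists_orthogonal_vector:
  fixes B :: "(complex^'n) set"
  assumes B: "orthonormal B" and c: "card B < CARD('n)"
  obtains v where "v \<noteq> 0" "\<And>b. b \<in> B \<Longrightarrow> cinner b v = 0"
proof -
  have fin: "finite B" using orthonormal_card[OF B] by blast
  have "vec.span B \<noteq> UNIV"
  proof
    assume "vec.span B = UNIV"
    then have "CARD('n) \<le> card B"
      using vec.dim_le_card[of UNIV B] fin by (simp only: vec_dim_card)
    then show False using c by simp
  qed
  then obtain x where x: "x \<notin> vec.span B" by blast
  define v where "v = x - (\<Sum>b\<in>B. cinner b x *s b)"
  have "v \<noteq> 0"
  proof
    assume "v = 0"
    then have "x = (\<Sum>b\<in>B. cinner b x *s b)" by (simp add: v_def)
    moreover have "(\<Sum>b\<in>B. cinner b x *s b) \<in> vec.span B"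
      by (intro vec.span_sum vec.span_scale vec.span_base)
    ultimately show False using x by metis
  qed
  moreover have "cinner b v = 0" if "b \<in> B" for b
  proof -
    have "(\<Sum>a\<in>B. cinner a x * cinner b a) = (\<Sum>a\<in>B. if a = b then cinner b x else 0)"
      using B that unfolding orthonormal_def by (intro sum.cong) auto
    then show ?thesis using fin that
      by (simp add: v_def cinner_diff_right cinner_sum_right cinner_scale_right)
  qed
  ultimately show ?thesis using that by blast
qed

section \<open>Finding eigenvectors with \<open>poly_vec\<close>, the value of q(A) v by Horner's
  scheme\<close>

definition poly_vec :: "complex poly \<Rightarrow> complex^'n^'n \<Rightarrow> complex^'n \<Rightarrow> complex^'n" where
  "poly_vec q A v = fold_coeffs (\<lambda>a w. a *s v + A *v w) q 0"

lemma poly_vec_0 [simp]: "poly_vec 0 A v = 0"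
  by (simp add: poly_vec_def)

lemma poly_vec_pCons [simp]: "poly_vec (pCons a q) A v = a *s v + A *v poly_vec q A v"
  by (cases "q = 0"; cases "a = 0") (auto simp: poly_vec_def)

lemma poly_vec_add: "poly_vec (p + q) A v = poly_vec p A v + poly_vec q A v"
proof (induction p q rule: poly_induct2)
  case (pCons a p b q)
  then show ?case by (simp add: vec.scale_left_distrib matrix_vector_right_distrib)
qed simp

lemma poly_vec_smult: "poly_vec (Polynomial.smult c p) A v = c *s poly_vec p A v"
  by (induction p) (auto simp: vec.scale_right_distrib vector_scalar_commute)

text \<open>Polynomials in \<open>A\<close> commute, so the linear factor may be applied to the
  vector first. This is the recursion step in the search for an eigenvector.\<close>

lemma poly_vec_mult_linear: "poly_vec ([:-z, 1:] * r) A v = poly_vec r A (A *v v - z *s v)"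
proof -
  have comm: "A *v poly_vec r A w = poly_vec r A (A *v w)" for w
    by (induction r) (auto simp: matrix_vector_right_distrib vector_scalar_commute)
  have lin: "poly_vec r A (w - z *s u) = poly_vec r A w - z *s poly_vec r A u" for w u
    by (induction r) (auto simp: matrix_vector_mult_diff_distrib matrix_vector_right_distrib
        vector_scalar_commute vec.scale_right_distrib vec.scale_right_diff_distrib mult.commute)
  have "[:-z, 1:] * r = pCons 0 r + Polynomial.smult (-z) r" by simp
  then show ?thesis
    by (simp only: poly_vec_add poly_vec_smult poly_vec_pCons lin comm) simp
qed

text \<open>Induction on the degree of \<open>q\<close>, splitting off a root \<open>z\<close> by
  the fundamental theorem of algebra. Either \<open>v\<close> is an eigenvector for
  \<open>z\<close>, or \<open>A *v v - z *s v\<close> is a nonzero element of \<open>W\<close>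
  killed by the cofactor.\<close>

lemma eigenvector_in_invariant_set_poly:
  assumes "\<And>w c. w \<in> W \<Longrightarrow> A *v w - c *s w \<in> W"
    and "q \<noteq> 0" "v \<in> W" "v \<noteq> 0" "poly_vec q A v = 0"
  shows "\<exists>w\<in>W. w \<noteq> 0 \<and> (\<exists>c. A *v w = c *s w)"
  using assms(2-)
proof (induction "Polynomial.degree q" arbitrary: q v)
  case 0
  then obtain a where "q = [:a:]" "a \<noteq> 0" by (metis degree_eq_zeroE pCons_0_0)
  then show ?case using 0 by simp
next
  case (Suc m)
  then have "\<not> constant (poly q)" by (simp add: constant_degree)
  then obtain z where "poly q z = 0" using fundamental_theorem_of_algebra by blast
  then obtain r where r: "q = [:-z, 1:] * r" using poly_eq_0_iff_dvd by blast
  then have r0: "r \<noteq> 0" using Suc.prems by auto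
  have deg: "m = Polynomial.degree r"
    using Suc.hyps(2) r0 unfolding r by (subst (asm) degree_mult_eq) auto
  show ?case
  proof (cases "A *v v - z *s v = 0")
    case True
    then show ?thesis using Suc.prems by auto
  next
    case False
    then show ?thesis
      using Suc.hyps(1)[OF deg r0 assms(1)[OF Suc.prems(2)]] Suc.prems(4)
      unfolding r poly_vec_mult_linear by blast
  qed
qed

text \<open>The n+1 vectors obtained from \<open>v\<close> by applying the powers of
  \<open>A\<close> up to the n-th are linearly dependent in dimension n; the coefficients of a
  relation are those of \<open>q\<close>.\<close>

lemma annihilating_poly:
  fixes A :: "complex^'n^'n"
  obtains q where "q \<noteq> 0" "poly_vec q A v = 0"
proof -
  define n where "n = CARD('n)"
  define p where "p j = ((*v) A ^^ j) v" for j
  have mono: "poly_vec (Polynomial.monom c j) A v = c *s p j" for c j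
    by (induction j) (auto simp: monom_0 monom_Suc p_def vector_scalar_commute)
  have ps: "poly_vec (\<Sum>j\<in>K. Polynomial.monom (c j) j) A v = (\<Sum>j\<in>K. c j *s p j)" for c K
    by (induction K rule: infinite_finite_induct) (auto simp: poly_vec_add mono)
  have cf: "poly.coeff (\<Sum>j\<in>K. Polynomial.monom (c j) j) i = (if i \<in> K then c i else 0)" if "finite K" for K i
    and c :: "nat \<Rightarrow> complex"
    using that by (simp add: coeff_sum if_distrib cong: if_cong)
  show ?thesis
  \<comment> \<open>Dependence is a property of the set of vectors, which does not record
    repetitions. A repetition gives a difference of two monomials instead.\<close>
  proof (cases "inj_on p {..n}")
    case False
    then obtain i j where ij: "i \<noteq> j" "p i = p j" unfolding inj_on_def by blast
    have "Polynomial.monom 1 i - Polynomial.monom (1::complex) j \<noteq> 0"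
      using ij by (auto simp: poly_eq_iff)
    moreover have "poly_vec (Polynomial.monom 1 i - Polynomial.monom 1 j) A v = 0"
      using poly_vec_add[of "Polynomial.monom 1 i" "Polynomial.smult (-1) (Polynomial.monom 1 j)" A v] ij
      by (simp only: poly_vec_smult mono) simp
    ultimately show ?thesis using that by blast
  next
    case True
    have "vec.dependent (p ` {..n})"
    proof (rule ccontr)
      assume "\<not> vec.dependent (p ` {..n})"
      then have "card (p ` {..n}) \<le> n"
        using vec.independent_bound_general[of "p ` {..n}"] dim_subset_UNIV_cart_gen[of "p ` {..n}"]
        by (auto simp: n_def)
      then show False using True by (simp add: card_image)
    qed
    then obtain u w where u: "(\<Sum>x\<in>p ` {..n}. u x *s x) = 0" "w \<in> p ` {..n}" "u w \<noteq> 0"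
      by (auto simp: vec.dependent_finite)
    define q where "q = (\<Sum>j\<le>n. Polynomial.monom (u (p j)) j)"
    have "poly_vec q A v = (\<Sum>x\<in>p ` {..n}. u x *s x)"
      unfolding q_def ps using True by (simp add: sum.reindex)
    moreover obtain j where "j \<le> n" "w = p j" using u by auto
    then have "poly.coeff q j \<noteq> 0" using u unfolding q_def by (subst cf) auto
    then have "q \<noteq> 0" by auto
    ultimately show ?thesis using that u by metis
  qed
qed

text \<open>For normal \<open>A\<close> the vectors (A - c) v and (adjoint of A - c) v have the same
  norm, seen by expanding the inner product. Consequently the orthogonal complement of a set of
  eigenvectors is invariant under \<open>A\<close>.\<close>

lemma normal_matrix_eigenvector_conj_transpose:
  fixes A :: "complex^'n^'n"
  assumes A: "normal_matrix A" and v: "A *v v = c *s v"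
  shows "conj_transpose A *v v = cnj c *s v"
proof -
  let ?A = "conj_transpose A"
  have "cinner (?A *v v - cnj c *s v) (?A *v v - cnj c *s v)
     = cinner (?A *v v) (?A *v v) - cnj c * cinner (?A *v v) v
       - c * cinner v (?A *v v) + c * cnj c * cinner v v"
    by (simp add: cinner_def algebra_simps sum.distrib sum_subtractf sum_distrib_left)
  moreover have "cinner (?A *v v) (?A *v v) = c * cnj c * cinner v v"
  proof -
    have "cinner (?A *v v) (?A *v v) = cinner v ((A ** ?A) *v v)"
      by (simp add: cinner_mult_vec[symmetric] matrix_vector_mul_assoc)
    also have "\<dots> = cinner v ((?A ** A) *v v)" using A by (simp add: normal_matrix_def)
    also have "\<dots> = cinner (A *v v) (A *v v)"
      by (simp add: cinner_mult_vec matrix_vector_mul_assoc[symmetric])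
    finally show ?thesis by (simp add: v cinner_scale_left cinner_scale_right)
  qed
  moreover have "cinner (?A *v v) v = c * cinner v v"
    by (simp add: cinner_mult_vec[symmetric] v cinner_scale_right)
  moreover have "cinner v (?A *v v) = cnj c * cinner v v"
    by (simp add: cinner_mult_vec v cinner_scale_left)
  ultimately have "cinner (?A *v v - cnj c *s v) (?A *v v - cnj c *s v) = 0"
    by (simp add: algebra_simps)
  then show ?thesis by (simp add: cinner_self)
qed

text \<open>A maximal orthonormal set of eigenvectors is a basis: otherwise its orthogonal
  complement, being invariant and nonzero, contains a further eigenvector, which can be normalised
  and added.\<close>

theorem normal_matrix_unitarily_diagonalizable:
  fixes A :: "complex^'n^'n"
  assumes A: "normal_matrix A"
  obtains U d where "unitary_matrix U" "A = U ** diag_matrix d ** conj_transpose U"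
proof -
  define P where "P B \<longleftrightarrow> orthonormal B \<and> (\<forall>b\<in>B. \<exists>c. A *v b = c *s b)" for B
  \<comment> \<open>The empty set satisfies \<open>P\<close>, and the cardinality of an orthonormal
    set is strictly below \<open>Suc CARD('n)\<close>.\<close>
  have "\<exists>B. P B \<and> (\<forall>B'. P B' \<longrightarrow> card B' \<le> card B)"
    by (rule Lattices_Big.ex_has_greatest_nat[of P "{}" card "Suc CARD('n)"])
      (auto simp: P_def orthonormal_def[of "{}"] less_Suc_eq_le orthonormal_card)
  then obtain B where B: "P B" and maxB: "\<And>B'. P B' \<Longrightarrow> card B' \<le> card B" by blast
  have oB: "orthonormal B" and eB: "\<And>b. b \<in> B \<Longrightarrow> \<exists>c. A *v b = c *s b"
    using B by (auto simp: P_def)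
  have fin: "finite B" using orthonormal_card[OF oB] by blast
  have cB: "card B = CARD('n)"
  proof (rule ccontr)
    assume "card B \<noteq> CARD('n)"
    then have "card B < CARD('n)" using orthonormal_card[OF oB] by linarith
    then obtain v where v: "v \<noteq> 0" "\<And>b. b \<in> B \<Longrightarrow> cinner b v = 0"
      using exists_orthogonal_vector[OF oB] by blast
    define W where "W = {w. \<forall>b\<in>B. cinner b w = 0}"
    have inv: "A *v w - c *s w \<in> W" if "w \<in> W" for w c
    proof -
      have "cinner b (A *v w) = 0" if "b \<in> B" for b
      proof -
        obtain c where "A *v b = c *s b" using eB \<open>b \<in> B\<close> by blast
        then have "conj_transpose A *v b = cnj c *s b"
          by (rule normal_matrix_eigenvector_conj_transpose[OF A])
        then show ?thesis using \<open>w \<in> W\<close> \<open>b \<in> B\<close>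
          by (simp add: cinner_mult_vec cinner_scale_left W_def)
      qed
      then show ?thesis using that by (simp add: W_def cinner_diff_right cinner_scale_right)
    qed
    obtain q where q: "q \<noteq> 0" "poly_vec q A v = 0" by (rule annihilating_poly)
    obtain w c where w: "w \<in> W" "w \<noteq> 0" "A *v w = c *s w"
      using eigenvector_in_invariant_set_poly[of W A q v, OF inv q(1) _ v(1) q(2)] v(2)
      by (auto simp: W_def)
    define u where "u = complex_of_real (inverse (norm w)) *s w"
    have "cinner u u = of_real (inverse (norm w)) * of_real (inverse (norm w)) * cinner w w"
      by (simp add: u_def cinner_scale_left cinner_scale_right)
    then have "cinner u u = of_real (inverse (norm w) * inverse (norm w) * (norm w)\<^sup>2)"
      by (simp only: cinner_self[of w] of_real_mult)
    also have "inverse (norm w) * inverse (norm w) * (norm w)\<^sup>2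
        = (inverse (norm w) * norm w) * (inverse (norm w) * norm w)"
      by (simp only: power2_eq_square mult_ac)
    also have "\<dots> = 1"
    proof -
      have "inverse (norm w) * norm w = 1" using w(2) by (intro left_inverse) simp
      then show ?thesis by simp
    qed
    finally have uu: "cinner u u = 1" by simp
    have bu: "cinner b u = 0" if "b \<in> B" for b
      using w(1) that by (simp add: u_def cinner_scale_right W_def)
    have ub: "cinner u b = 0" if "b \<in> B" for b
      using bu[OF that] cinner_commute[of u b] by simp
    have "u \<notin> B" using bu uu by fastforce
    have "P (insert u B)"
    proof -
      have "A *v u = c *s u" by (simp add: u_def w(3) vector_scalar_commute mult.commute)
      then show ?thesis
        using oB eB uu bu ub \<open>u \<notin> B\<close> unfolding P_def orthonormal_def by auto
    qed
    then show False using maxB[of "insert u B"] fin \<open>u \<notin> B\<close> by simp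
  qed
  obtain f :: "'n \<Rightarrow> complex^'n" where f: "bij_betw f UNIV B"
    using finite_same_card_bij[of "UNIV :: 'n set" B] fin cB by auto
  have fB: "f i \<in> B" for i using f by (auto simp: bij_betw_def)
  obtain d where d: "\<And>i. A *v f i = d i *s f i"
    using choice[of "\<lambda>i c. A *v f i = c *s f i"] eB fB by blast
  \<comment> \<open>The columns are the orthonormal eigenvectors, so the adjoint of \<open>U\<close>
    times \<open>U\<close> is their Gram matrix.\<close>
  define U :: "complex^'n^'n" where "U = (\<chi> i j. f j $ i)"
  have U: "unitary_matrix U"
  proof -
    have "(conj_transpose U ** U) $ i $ j = cinner (f i) (f j)" for i j
      by (simp add: matrix_matrix_mult_def U_def cinner_def)
    moreover have "cinner (f i) (f j) = (if i = j then 1 else 0)" for i j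
    proof -
      have "f i = f j \<longleftrightarrow> i = j" using f by (auto simp: bij_betw_def inj_on_def)
      then show ?thesis using oB fB unfolding orthonormal_def by simp
    qed
    ultimately show ?thesis by (simp add: unitary_matrix_def vec_eq_iff mat_def)
  qed
  have "A ** U = U ** diag_matrix d"
  proof -
    have "(A ** U) $ i $ j = (A *v f j) $ i" for i j
      by (simp add: matrix_matrix_mult_def matrix_vector_mult_def U_def)
    then show ?thesis by (simp add: vec_eq_iff d) (simp add: U_def mult.commute)
  qed
  then have "A ** U ** conj_transpose U = U ** diag_matrix d ** conj_transpose U" by simp
  moreover have "A ** U ** conj_transpose U = A"
    by (simp add: matrix_mul_assoc[symmetric] unitary_matrixD(2)[OF U])
  ultimately have "A = U ** diag_matrix d ** conj_transpose U" by simp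
  then show ?thesis using that U by blast
qed

subsection \<open>Normal matrices near a diagonal matrix\<close>

lemma unitary_conj_nth:
  "(U ** diag_matrix x ** conj_transpose U) $ i $ j = (\<Sum>k\<in>UNIV. U $ i $ k * x k * cnj (U $ j $ k))"
proof -
  have "(U ** diag_matrix x ** conj_transpose U) $ i $ j
    = (\<Sum>k\<in>UNIV. (U ** diag_matrix x) $ i $ k * conj_transpose U $ k $ j)"
    by (simp add: matrix_matrix_mult_def[of "U ** diag_matrix x"])
  then show ?thesis by simp
qed

lemma diag_matrix_const_commute: "M ** diag_matrix (\<lambda>_. w) = diag_matrix (\<lambda>_. w) ** M"
  for M :: "complex^'n^'n"
  by (simp add: vec_eq_iff mult.commute)

lemma finite_range_gap:
  fixes d :: "'n::finite \<Rightarrow> 'a::metric_space"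
  obtains \<delta> where "\<delta> > 0" "\<And>i j. d i \<noteq> d j \<Longrightarrow> \<delta> \<le> dist (d i) (d j)"
proof -
  \<comment> \<open>The extra element 1 keeps the set nonempty when \<open>d\<close> is
    constant.\<close>
  let ?S = "insert 1 ((\<lambda>(i,j). dist (d i) (d j)) ` {(i,j). d i \<noteq> d j})"
  have "Min ?S > 0" by (subst Min_gr_iff) auto
  moreover have "Min ?S \<le> dist (d i) (d j)" if "d i \<noteq> d j" for i j
    by (rule Min_le) (use that in auto)
  ultimately show ?thesis using that by blast
qed

text \<open>The spectral projection of \<open>diag_matrix d\<close> for the value
  \<open>z\<close>.\<close>

definition block_projection :: "('n \<Rightarrow> complex) \<Rightarrow> complex \<Rightarrow> complex^'n^'n" where
  "block_projection d z = diag_matrix (\<lambda>i. if d i = z then 1 else 0)"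

text \<open>Each value of \<open>d\<close> has an eigenvalue of \<open>a\<close> nearby, and values
  of \<open>d\<close> that differ get different ones. Having equally many distinct eigenvalues,
  \<open>a\<close> has no others, so no eigenvalue of \<open>diag_matrix d\<close> splits and the
  projections \<open>P z\<close> add up to the identity. Rows of \<open>P z\<close> outside the
  block of \<open>z\<close> are small by the eigenvalue equation, and those inside it are controlled
  by the sum.\<close>

lemma spectral_projections_near_diag:
  fixes d :: "'n::finite \<Rightarrow> complex"
  obtains C \<epsilon> where "C > 0" "\<epsilon> > 0"
    "\<And>U c a. unitary_matrix U \<Longrightarrow> card (range c) = card (range d) \<Longrightarrow>
       a = U ** diag_matrix c ** conj_transpose U \<Longrightarrow> norm (a - diag_matrix d) \<le> \<epsilon> \<Longrightarrow>
       \<exists>g P. \<forall>z\<in>range d. a ** P z = diag_matrix (\<lambda>_. g z) ** P z \<and>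
         P z ** a = diag_matrix (\<lambda>_. g z) ** P z \<and>
         norm (P z - block_projection d z) \<le> C * norm (a - diag_matrix d)"
proof -
  define n where "n = real CARD('n)"
  define K where "K = n\<^sup>2"
  have n1: "n \<ge> 1" by (simp add: n_def Suc_leI)
  have K1: "K \<ge> 1" using n1 by (simp add: K_def)
  obtain \<delta> where \<delta>: "\<delta> > 0" "\<And>i j. d i \<noteq> d j \<Longrightarrow> \<delta> \<le> dist (d i) (d j)"
    by (rule finite_range_gap[of d]) blast
  \<comment> \<open>\<open>K^3\<close> bounds the norm of a spectral projection,
    \<open>2 / \<delta>\<close> inverts half the gap, \<open>n\<close> bounds the number of
    remaining eigenvalues, and the outer \<open>K\<close> passes from entries to the norm. The
    radius \<open>\<epsilon>\<close> is chosen so that eigenvalues move by at most a quarter of the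
    gap.\<close>
  define C where "C = K * (n * (2 / \<delta> * K^3))"
  define \<epsilon> where "\<epsilon> = \<delta> / (4 * n * K)"
  have C: "C > 0" using n1 K1 \<delta> by (simp add: C_def)
  have \<epsilon>: "\<epsilon> > 0" using n1 K1 \<delta> by (simp add: \<epsilon>_def)
  have main: "\<exists>g P. \<forall>z\<in>range d. a ** P z = diag_matrix (\<lambda>_. g z) ** P z \<and>
         P z ** a = diag_matrix (\<lambda>_. g z) ** P z \<and>
         norm (P z - block_projection d z) \<le> C * norm (a - diag_matrix d)"
    if U: "unitary_matrix U" and card: "card (range c) = card (range d)"
      and a: "a = U ** diag_matrix c ** conj_transpose U" and near: "norm (a - diag_matrix d) \<le> \<epsilon>"
    for U c a
  proof -
    define x where "x = norm (a - diag_matrix d)"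
    have x0: "x \<ge> 0" by (simp add: x_def)
    have nU: "norm U \<le> K" using norm_unitary_matrix_le[OF U] by (simp add: K_def n_def)
    have xb: "n * K * x \<le> \<delta> / 4"
    proof -
      have "n * K * x \<le> n * K * \<epsilon>"
        using near n1 K1 by (intro mult_left_mono) (auto simp: x_def)
      then show ?thesis using n1 K1 by (simp add: \<epsilon>_def)
    qed
    \<comment> \<open>Entry (k, i) of the adjoint of \<open>U\<close> times the perturbation is
      \<open>c k - d i\<close> times the conjugate of \<open>U $ i $ k\<close>. Choosing
      \<open>k\<close> with a large entry of \<open>U\<close> forces \<open>c k\<close> close to
      \<open>d i\<close>.\<close>
    have "\<exists>w\<in>range c. dist w (d i) \<le> n * K * x" for i
    proof -
      obtain k where k: "norm (U $ i $ k) \<ge> 1 / n"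
        using unitary_matrix_row_large_entry[OF U] unfolding n_def by blast
      have "conj_transpose U ** a = diag_matrix c ** conj_transpose U"
        unfolding a by (simp add: matrix_mul_assoc unitary_matrixD(1)[OF U])
      then have "conj_transpose U ** (a - diag_matrix d)
          = diag_matrix c ** conj_transpose U - conj_transpose U ** diag_matrix d"
        by (simp add: matrix_mult_distribs)
      then have "(conj_transpose U ** (a - diag_matrix d)) $ k $ i = (c k - d i) * cnj (U $ i $ k)"
        by (simp add: left_diff_distrib mult.commute)
      then have "norm (c k - d i) * norm (U $ i $ k) \<le> norm (conj_transpose U ** (a - diag_matrix d))"
        by (metis norm_entry_le norm_mult complex_mod_cnj)
      also have "\<dots> \<le> K * x"
        using norm_matrix_mult_le[of "conj_transpose U" "a - diag_matrix d"] mult_right_mono[OF nU x0]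
        by (simp add: x_def)
      finally have "norm (c k - d i) * norm (U $ i $ k) \<le> K * x" .
      moreover have "norm (c k - d i) * (1 / n) \<le> norm (c k - d i) * norm (U $ i $ k)"
        using k by (intro mult_left_mono) auto
      ultimately have "norm (c k - d i) * (1 / n) \<le> K * x" by linarith
      then have "norm (c k - d i) \<le> n * K * x" using n1 by (simp add: field_simps)
      then show ?thesis by (auto simp: dist_norm)
    qed
    then have "\<forall>z\<in>range d. \<exists>w. w \<in> range c \<and> dist w z \<le> n * K * x" by blast
    then obtain g where g: "\<And>z. z \<in> range d \<Longrightarrow> g z \<in> range c"
      and gd: "\<And>z. z \<in> range d \<Longrightarrow> dist (g z) z \<le> n * K * x"
      using bchoice[of "range d" "\<lambda>z w. w \<in> range c \<and> dist w z \<le> n * K * x"] by blast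
    have sep: "dist (g z) (d i) \<ge> \<delta> / 2" if "z \<in> range d" "d i \<noteq> z" for z i
    proof -
      have "\<delta> \<le> dist z (d i)" using that \<delta>(2) by (metis rangeE)
      then show ?thesis
        using gd[OF that(1)] xb dist_triangle[of z "d i" "g z"] \<delta>(1) by (simp add: dist_commute)
    qed
    have ginj: "inj_on g (range d)"
    proof (rule inj_onI)
      fix z w assume zw: "z \<in> range d" "w \<in> range d" "g z = g w"
      show "z = w"
      proof (rule ccontr)
        assume "z \<noteq> w"
        then have "\<delta> / 2 \<le> dist (g w) w" using sep[of z] zw by force
        then show False using gd[OF zw(2)] xb \<delta>(1) by linarith
      qed
    qed
    \<comment> \<open>The hypothesis on the number of eigenvalues makes the injection
      \<open>g\<close> onto.\<close>
    have gim: "g ` range d = range c"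
      using g by (intro card_subset_eq) (auto simp: card_image[OF ginj] card)
    define e where "e z k = (if c k = g z then 1 else 0 :: complex)" for z k
    define P where "P z = U ** diag_matrix (e z) ** conj_transpose U" for z
    have ce: "(\<lambda>k. c k * e z k) = (\<lambda>k. g z * e z k)" for z by (auto simp: e_def)
    have gP: "U ** diag_matrix (\<lambda>k. g z * e z k) ** conj_transpose U = diag_matrix (\<lambda>_. g z) ** P z" for z
      unfolding P_def diag_matrix_mult[symmetric]
      by (simp add: matrix_mul_assoc diag_matrix_const_commute)
    have aP: "a ** P z = diag_matrix (\<lambda>_. g z) ** P z" for z
      unfolding gP[symmetric] by (simp add: a P_def unitary_conj_mult[OF U] diag_matrix_mult ce)
    have Pa: "P z ** a = diag_matrix (\<lambda>_. g z) ** P z" for z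
      unfolding gP[symmetric]
      by (simp add: a P_def unitary_conj_mult[OF U] diag_matrix_mult mult.commute[of "e z _"] ce)
    have sumP: "(\<Sum>z\<in>range d. P z $ i $ j) = (if i = j then 1 else 0)" for i j
    proof -
      have e1: "(\<Sum>z\<in>range d. e z k) = 1" for k
      proof -
        have "c k \<in> g ` range d" using gim by blast
        then obtain z where z: "z \<in> range d" "c k = g z" by blast
        have "(\<Sum>y\<in>range d. e y k) = (\<Sum>y\<in>range d. if y = z then 1 else 0)"
          using z ginj by (intro sum.cong) (auto simp: e_def dest: inj_onD)
        then show ?thesis using z by simp
      qed
      have "(\<Sum>z\<in>range d. P z $ i $ j)
          = (\<Sum>k\<in>UNIV. \<Sum>z\<in>range d. U $ i $ k * e z k * cnj (U $ j $ k))"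
        unfolding P_def unitary_conj_nth by (rule sum.swap)
      also have "\<dots> = (\<Sum>k\<in>UNIV. U $ i $ k * (\<Sum>z\<in>range d. e z k) * cnj (U $ j $ k))"
        by (simp add: sum_distrib_left sum_distrib_right)
      also have "\<dots> = (U ** conj_transpose U) $ i $ j"
        unfolding e1 by (simp add: matrix_matrix_mult_def)
      finally show ?thesis using unitary_matrixD(2)[OF U] by (simp add: mat_def)
    qed
    have nP: "norm (P z) \<le> K^3" for z
    proof -
      have "norm (diag_matrix (e z)) \<le> K"
        using norm_matrix_le_entries[of "diag_matrix (e z)" 1]
        by (auto simp: diag_matrix_nth e_def K_def n_def)
      then have "norm (U ** diag_matrix (e z)) \<le> K * K"
        using norm_matrix_mult_le[of U "diag_matrix (e z)"] nU K1
        by (meson mult_mono norm_ge_zero order_trans zero_le_one)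
      then have "norm (U ** diag_matrix (e z)) * norm (conj_transpose U) \<le> K * K * K"
        using nU K1 by (intro mult_mono) auto
      then show ?thesis
        unfolding P_def using norm_matrix_mult_le[of "U ** diag_matrix (e z)" "conj_transpose U"]
        by (simp add: power3_eq_cube)
    qed
    \<comment> \<open>On row \<open>i\<close>, multiplying \<open>P z\<close> by
      \<open>a - diag_matrix d\<close> from the left is multiplication by \<open>g z - d i\<close>,
      which is at least \<open>\<delta> / 2\<close> in modulus.\<close>
    have off: "norm (P z $ i $ j) \<le> 2 / \<delta> * K^3 * x" if z: "z \<in> range d" "d i \<noteq> z" for z i j
    proof -
      have "((a - diag_matrix d) ** P z) $ i $ j = (g z - d i) * P z $ i $ j"
        by (simp add: matrix_mult_distribs aP algebra_simps)
      then have "dist (g z) (d i) * norm (P z $ i $ j) \<le> norm ((a - diag_matrix d) ** P z)"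
        by (metis norm_entry_le norm_mult dist_norm)
      also have "\<dots> \<le> x * K^3"
        using norm_matrix_mult_le[of "a - diag_matrix d" "P z"] mult_left_mono[OF nP[of z] x0]
        by (simp add: x_def)
      finally have "dist (g z) (d i) * norm (P z $ i $ j) \<le> x * K^3" .
      moreover have "\<delta> / 2 * norm (P z $ i $ j) \<le> dist (g z) (d i) * norm (P z $ i $ j)"
        using sep[OF z] by (intro mult_right_mono) auto
      ultimately have "\<delta> / 2 * norm (P z $ i $ j) \<le> x * K^3" by linarith
      then show ?thesis using \<delta>(1) by (simp add: field_simps)
    qed
    define b where "b = 2 / \<delta> * K^3 * x"
    have b0: "b \<ge> 0" using \<delta>(1) K1 x0 by (simp add: b_def)
    have entry: "norm ((P z - block_projection d z) $ i $ j) \<le> n * b" if z: "z \<in> range d" for z i j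
    proof (cases "d i = z")
      case False
      then have "norm ((P z - block_projection d z) $ i $ j) = norm (P z $ i $ j)"
        by (auto simp: block_projection_def diag_matrix_nth)
      also have "\<dots> \<le> 1 * b" using off[OF z False] by (simp add: b_def)
      also have "\<dots> \<le> n * b" using n1 b0 by (intro mult_right_mono)
      finally show ?thesis .
    next
      case True
      \<comment> \<open>On row \<open>i\<close> the block projection agrees with the identity, that
        is, with the sum of all \<open>P y\<close>. The error is minus the sum of the other
        projections, for which row \<open>i\<close> lies outside the block.\<close>
      have "(\<Sum>y\<in>range d. P y $ i $ j) = P z $ i $ j + (\<Sum>y\<in>range d - {z}. P y $ i $ j)"
        using z by (intro sum.remove) auto
      moreover have "(P z - block_projection d z) $ i $ j = P z $ i $ j - (\<Sum>y\<in>range d. P y $ i $ j)"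
        using sumP[of i j] True by (auto simp: block_projection_def diag_matrix_nth)
      ultimately have "(P z - block_projection d z) $ i $ j = - (\<Sum>y\<in>range d - {z}. P y $ i $ j)"
        by simp
      then have "norm ((P z - block_projection d z) $ i $ j) \<le> (\<Sum>y\<in>range d - {z}. norm (P y $ i $ j))"
        by (simp add: norm_sum)
      also have "\<dots> \<le> (\<Sum>y\<in>range d - {z}. b)"
        unfolding b_def using True by (intro sum_mono off) auto
      also have "\<dots> = real (card (range d - {z})) * b" by simp
      also have "\<dots> \<le> n * b"
      proof -
        have "card (range d - {z}) \<le> card (range d)" by (simp add: card_mono)
        also have "\<dots> \<le> CARD('n)" by (rule card_image_le) simp
        finally show ?thesis unfolding n_def using b0 by (intro mult_right_mono) auto
      qed
      finally show ?thesis .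
    qed
    have "norm (P z - block_projection d z) \<le> C * norm (a - diag_matrix d)" if "z \<in> range d" for z
      using norm_matrix_le_entries[of "P z - block_projection d z" "n * b"] entry[OF that]
      by (simp add: C_def b_def x_def K_def n_def mult_ac)
    then show ?thesis using aP Pa by blast
  qed
  show ?thesis using that[OF C \<epsilon>] main by blast
qed

text \<open>The difference \<open>\<Delta>\<close> of two such matrices is bounded entry by entry by
  a small multiple of its own norm \<open>N\<close>. Summing the bounds gives
  \<open>N \<le> 1 / 2 * N\<close>, hence equality.\<close>

lemma normal_matrix_locally_determined:
  fixes d :: "'n::finite \<Rightarrow> complex"
  assumes L: "\<And>i j. d i \<noteq> d j \<Longrightarrow> (i, j) \<in> L \<or> (j, i) \<in> L"
    and R: "\<And>i. \<exists>r\<in>R. d r = d i"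
  obtains \<epsilon> where "\<epsilon> > 0"
    "\<And>a b. normal_matrix a \<Longrightarrow> card (eigenvalues a) = card (range d) \<Longrightarrow>
       normal_matrix b \<Longrightarrow> card (eigenvalues b) = card (range d) \<Longrightarrow>
       norm (a - diag_matrix d) < \<epsilon> \<Longrightarrow> norm (b - diag_matrix d) < \<epsilon> \<Longrightarrow>
       (\<And>i j. (i, j) \<in> L \<Longrightarrow> a $ i $ j = b $ i $ j) \<Longrightarrow>
       (\<And>r. r \<in> R \<Longrightarrow> a $ r $ r = b $ r $ r) \<Longrightarrow> a = b"
proof -
  define K where "K = (real CARD('n))\<^sup>2"
  have K1: "K \<ge> 1" by (simp add: K_def Suc_leI)
  obtain \<delta> where \<delta>: "\<delta> > 0" "\<And>i j. d i \<noteq> d j \<Longrightarrow> \<delta> \<le> dist (d i) (d j)"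
    by (rule finite_range_gap[of d]) blast
  obtain C \<epsilon>0 where C: "C > 0" "\<epsilon>0 > 0" and proj:
    "\<And>U c a. unitary_matrix U \<Longrightarrow> card (range c) = card (range d) \<Longrightarrow>
       a = U ** diag_matrix c ** conj_transpose U \<Longrightarrow> norm (a - diag_matrix d) \<le> \<epsilon>0 \<Longrightarrow>
       \<exists>g P. \<forall>z\<in>range d. a ** P z = diag_matrix (\<lambda>_. g z) ** P z \<and>
         P z ** a = diag_matrix (\<lambda>_. g z) ** P z \<and>
         norm (P z - block_projection d z) \<le> C * norm (a - diag_matrix d)"
    by (rule spectral_projections_near_diag[of d]) blast
  \<comment> \<open>\<open>C1\<close> is the error constant of \<open>sandwich\<close>.
    \<open>T\<close> adds up the three constants whose products with the distance \<open>x\<close>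
    have to be small: for the norms of the projections, for the invertibility of a diagonal entry of
    \<open>Q z ** P z\<close>, and for the final contraction.\<close>
  define C1 where "C1 = C * (2 * K + 1)"
  define T where "T = C + C1 * K + K * (5 * C1 + 4 / \<delta>)"
  have C1: "C1 > 0" using C K1 by (simp add: C1_def)
  have T: "T > 0" using C C1 K1 \<delta> by (simp add: T_def add_pos_pos)
  define \<epsilon> where "\<epsilon> = min \<epsilon>0 (1 / (2 * T))"
  have \<epsilon>: "\<epsilon> > 0" using C T by (simp add: \<epsilon>_def)
  have main: "a = b"
    if normal: "normal_matrix a" "normal_matrix b"
      and evs: "card (eigenvalues a) = card (range d)" "card (eigenvalues b) = card (range d)"
      and na: "norm (a - diag_matrix d) < \<epsilon>" and nb: "norm (b - diag_matrix d) < \<epsilon>"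
      and eqL: "\<And>i j. (i, j) \<in> L \<Longrightarrow> a $ i $ j = b $ i $ j"
      and eqR: "\<And>r. r \<in> R \<Longrightarrow> a $ r $ r = b $ r $ r" for a b
  proof -
    obtain U c where U: "unitary_matrix U" "a = U ** diag_matrix c ** conj_transpose U"
      by (rule normal_matrix_unitarily_diagonalizable[OF normal(1)])
    obtain V e where V: "unitary_matrix V" "b = V ** diag_matrix e ** conj_transpose V"
      by (rule normal_matrix_unitarily_diagonalizable[OF normal(2)])
    have cards: "card (range c) = card (range d)" "card (range e) = card (range d)"
      using evs unfolding U(2) V(2) eigenvalues_unitary_conj[OF U(1)] eigenvalues_unitary_conj[OF V(1)] .
    define D where "D = diag_matrix d"
    define \<Delta> where "\<Delta> = a - b"
    define N where "N = norm \<Delta>"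
    define x where "x = max (norm (a - D)) (norm (b - D))"
    have x: "x \<ge> 0" "x < \<epsilon>" "norm (a - D) \<le> x" "norm (b - D) \<le> x"
      using na nb by (auto simp: x_def D_def le_max_iff_disj)
    have N0: "N \<ge> 0" by (simp add: N_def)
    have Tx: "T * x \<le> 1 / 2"
    proof -
      have "T * x \<le> T * (1 / (2 * T))" using x(2) T by (intro mult_left_mono) (auto simp: \<epsilon>_def)
      then show ?thesis using T by simp
    qed
    have parts: "0 \<le> C * x" "0 \<le> C1 * K * x" "0 \<le> K * (5 * C1 + 4 / \<delta>) * x"
      using C C1 K1 \<delta> x by (auto intro!: mult_nonneg_nonneg add_nonneg_nonneg)
    have Tsum: "T * x = C * x + C1 * K * x + K * (5 * C1 + 4 / \<delta>) * x"
      by (simp add: T_def algebra_simps)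
    have Cx: "C * x \<le> 1" "C1 * K * x \<le> 1 / 2" "K * (5 * C1 + 4 / \<delta>) * x \<le> 1 / 2"
      using Tx parts unfolding Tsum by linarith+
    obtain ga P where P: "\<And>z. z \<in> range d \<Longrightarrow> a ** P z = diag_matrix (\<lambda>_. ga z) ** P z"
      and nP: "\<And>z. z \<in> range d \<Longrightarrow> norm (P z - block_projection d z) \<le> C * norm (a - D)"
      using proj[OF U(1) cards(1) U(2)] na unfolding \<epsilon>_def D_def by fastforce
    obtain gb Q where Q: "\<And>z. z \<in> range d \<Longrightarrow> Q z ** b = diag_matrix (\<lambda>_. gb z) ** Q z"
      and nQ: "\<And>z. z \<in> range d \<Longrightarrow> norm (Q z - block_projection d z) \<le> C * norm (b - D)"
      using proj[OF V(1) cards(2) V(2)] nb unfolding \<epsilon>_def D_def by fastforce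
    have nE: "norm (block_projection d z) \<le> K" for z
      using norm_matrix_le_entries[of "block_projection d z" 1]
      by (auto simp: block_projection_def diag_matrix_nth K_def)
    \<comment> \<open>Replaces the projections of \<open>a\<close> and \<open>b\<close> by that of
      \<open>diag_matrix d\<close>, one factor at a time, so that single entries of \<open>M\<close>
      in the block can be read off.\<close>
    have sandwich: "norm (Q z ** M ** P z - block_projection d z ** M ** block_projection d z)
        \<le> C1 * x * norm M" if z: "z \<in> range d" for z M
    proof -
      let ?E = "block_projection d z"
      have p: "norm (P z - ?E) \<le> C * x" and q: "norm (Q z - ?E) \<le> C * x"
        using nP[OF z] nQ[OF z] x C by (meson mult_left_mono order_trans less_imp_le)+
      have Pb: "norm (P z) \<le> K + 1"
        using p Cx(1) nE[of z] norm_triangle_ineq[of "P z - ?E" ?E] by simp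
      have eq: "Q z ** M ** P z - ?E ** M ** ?E = ?E ** M ** (P z - ?E) + (Q z - ?E) ** M ** P z"
        by (simp add: matrix_mult_distribs)
      have m3: "norm (X ** Y ** Z) \<le> u * norm Y * w" if "norm X \<le> u" "norm Z \<le> w"
        for X Y Z :: "complex^'n^'n" and u w
      proof -
        have u0: "0 \<le> u" using that(1) norm_ge_zero order_trans by blast
        have "norm (X ** Y) \<le> u * norm Y"
          using norm_matrix_mult_le[of X Y] that(1) by (meson mult_right_mono norm_ge_zero order_trans)
        then have "norm (X ** Y) * norm Z \<le> u * norm Y * w"
          using that(2) u0 by (intro mult_mono) auto
        then show ?thesis using norm_matrix_mult_le[of "X ** Y" Z] by linarith
      qed
      have "norm (?E ** M ** (P z - ?E)) \<le> K * norm M * (C * x)" using nE p by (rule m3)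
      moreover have "norm ((Q z - ?E) ** M ** P z) \<le> (C * x) * norm M * (K + 1)" using q Pb by (rule m3)
      ultimately have "norm (Q z ** M ** P z - ?E ** M ** ?E)
          \<le> K * norm M * (C * x) + (C * x) * norm M * (K + 1)"
        unfolding eq by (meson norm_triangle_ineq order_trans add_mono)
      also have "\<dots> = C1 * x * norm M" by (simp add: C1_def algebra_simps)
      finally show ?thesis .
    qed
    have Eentry: "(block_projection d z ** M ** block_projection d z) $ i $ j = M $ i $ j"
      if "d i = z" "d j = z" for M z i j
      using that by (simp add: block_projection_def)
    have same: "norm (\<Delta> $ i $ j) \<le> 5 * C1 * x * N" if ij: "d i = d j" for i j
    proof -
      define z where "z = d i"
      have z: "z \<in> range d" by (simp add: z_def)
      obtain r where r: "r \<in> R" "d r = z" using R z_def by blast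
      define \<eta> where "\<eta> = ga z - gb z"
      \<comment> \<open>\<open>P z\<close> turns \<open>a\<close> on its left into the scalar
        \<open>ga z\<close>, and \<open>Q z\<close> turns \<open>b\<close> on its right into
        \<open>gb z\<close>.\<close>
      have QDP: "(Q z ** \<Delta> ** P z) $ k $ l = \<eta> * (Q z ** P z) $ k $ l" for k l
      proof -
        have "Q z ** \<Delta> ** P z = Q z ** (a ** P z) - (Q z ** b) ** P z"
          by (simp add: \<Delta>_def matrix_mult_distribs matrix_mul_assoc)
        also have "\<dots> = diag_matrix (\<lambda>_. ga z) ** (Q z ** P z) - diag_matrix (\<lambda>_. gb z) ** (Q z ** P z)"
          unfolding P[OF z] Q[OF z] by (simp add: matrix_mul_assoc diag_matrix_const_commute)
        finally show ?thesis by (simp add: \<eta>_def left_diff_distrib)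
      qed
      \<comment> \<open>The estimate \<open>sandwich\<close> with the identity in the
        middle.\<close>
      have QP: "norm ((Q z ** P z) $ k $ l - (mat 1 :: complex^'n^'n) $ k $ l) \<le> 1 / 2"
        if "d k = z" "d l = z" for k l
      proof -
        have "norm (mat 1 :: complex^'n^'n) \<le> K"
          using norm_matrix_le_entries[of "mat 1 :: complex^'n^'n" 1] by (auto simp: mat_def K_def)
        then have "C1 * x * norm (mat 1 :: complex^'n^'n) \<le> C1 * x * K"
          using C1 x by (intro mult_left_mono) auto
        then have "norm (Q z ** mat 1 ** P z - block_projection d z ** mat 1 ** block_projection d z) \<le> 1 / 2"
          using sandwich[OF z, of "mat 1"] Cx(2) by (simp add: mult_ac)
        then show ?thesis
          using norm_entry_le[of "Q z ** mat 1 ** P z - block_projection d z ** mat 1 ** block_projection d z" k l]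
            Eentry[OF that, of "mat 1"] by simp
      qed
      have QDP': "norm (\<eta> * (Q z ** P z) $ k $ l - \<Delta> $ k $ l) \<le> C1 * x * N"
        if "d k = z" "d l = z" for k l
        using norm_entry_le[of "Q z ** \<Delta> ** P z - block_projection d z ** \<Delta> ** block_projection d z" k l]
          sandwich[OF z, of \<Delta>] Eentry[OF that, of \<Delta>] QDP[of k l] by (simp add: N_def)
      \<comment> \<open>The one prescribed diagonal entry of the block controls the eigenvalue
        difference \<open>\<eta>\<close>, because the factor at (r, r) has modulus at least
        1/2.\<close>
      have "\<Delta> $ r $ r = 0" using eqR[OF r(1)] by (simp add: \<Delta>_def)
      then have 1: "norm \<eta> * norm ((Q z ** P z) $ r $ r) \<le> C1 * x * N"
        using QDP'[OF r(2) r(2)] by (simp add: norm_mult)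
      have "norm ((Q z ** P z) $ r $ r) \<ge> 1 / 2"
        using QP[OF r(2) r(2)] norm_triangle_ineq2[of 1 "1 - (Q z ** P z) $ r $ r"]
        by (simp add: mat_def norm_minus_commute)
      then have "norm \<eta> * (1 / 2) \<le> norm \<eta> * norm ((Q z ** P z) $ r $ r)"
        by (intro mult_left_mono) auto
      then have \<eta>: "norm \<eta> \<le> 2 * C1 * x * N" using 1 by simp
      have dz: "d i = z" "d j = z" using ij by (auto simp: z_def)
      have "norm ((mat 1 :: complex^'n^'n) $ i $ j) \<le> 1" by (simp add: mat_def)
      then have "norm ((Q z ** P z) $ i $ j) \<le> 2"
        using QP[OF dz] norm_triangle_ineq2[of "(Q z ** P z) $ i $ j" "(mat 1 :: complex^'n^'n) $ i $ j"]
        by linarith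
      then have "norm \<eta> * norm ((Q z ** P z) $ i $ j) \<le> (2 * C1 * x * N) * 2"
        using \<eta> order_trans[OF norm_ge_zero \<eta>] by (intro mult_mono) auto
      \<comment> \<open>The constant 5 is 2 times 2 from the product with \<open>\<eta>\<close>,
        plus 1 from the sandwich error.\<close>
      moreover have "norm (\<Delta> $ i $ j) \<le> norm (\<eta> * (Q z ** P z) $ i $ j) + C1 * x * N"
        using QDP'[OF dz] norm_triangle_ineq2[of "\<Delta> $ i $ j" "\<eta> * (Q z ** P z) $ i $ j"]
        by (simp add: norm_minus_commute)
      ultimately show ?thesis by (simp add: norm_mult)
    qed
    have off: "norm (\<Delta> $ i $ j) \<le> 4 / \<delta> * x * N" if ij: "d i \<noteq> d j" for i j
    proof (cases "(i, j) \<in> L")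
      case True
      then show ?thesis using eqL \<delta> x N0 by (simp add: \<Delta>_def)
    next
      case False
      then have "(j, i) \<in> L" using L ij by blast
      then have z: "\<Delta> $ j $ i = 0" using eqL by (simp add: \<Delta>_def)
      define \<alpha> where "\<alpha> = a - D"
      define \<beta> where "\<beta> = b - D"
      let ?t = conj_transpose
      have ab: "a = D + \<alpha>" "b = D + \<beta>" by (auto simp: \<alpha>_def \<beta>_def)
      have "a ** ?t a = ?t a ** a" "b ** ?t b = ?t b ** b"
        using normal by (auto simp: normal_matrix_def)
      \<comment> \<open>The difference of the two normality equations, telescoped so that every term
        contains \<open>\<Delta>\<close> once. Splitting off \<open>D\<close> then leaves four
        remainder terms, each of norm at most \<open>x * N\<close>.\<close>
      then have "a ** ?t \<Delta> + \<Delta> ** ?t b - ?t a ** \<Delta> - ?t \<Delta> ** b = 0"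
        by (simp add: \<Delta>_def matrix_mult_distribs conj_transpose_diff)
      then have comm: "D ** ?t \<Delta> + \<Delta> ** ?t D - ?t D ** \<Delta> - ?t \<Delta> ** D
          = ?t \<alpha> ** \<Delta> + ?t \<Delta> ** \<beta> - \<alpha> ** ?t \<Delta> - \<Delta> ** ?t \<beta>"
        unfolding ab by (simp add: matrix_mult_distribs conj_transpose_add algebra_simps)
      \<comment> \<open>The terms with the adjoint of \<open>\<Delta>\<close> involve the entry (j,
        i), which vanishes; so one orientation of each index pair determines the other.\<close>
      have "(D ** ?t \<Delta> + \<Delta> ** ?t D - ?t D ** \<Delta> - ?t \<Delta> ** D) $ i $ j = \<Delta> $ i $ j * cnj (d j - d i)"
        using z by (simp add: D_def conj_transpose_diag_matrix algebra_simps)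
      then have "dist (d i) (d j) * norm (\<Delta> $ i $ j)
          = norm ((?t \<alpha> ** \<Delta> + ?t \<Delta> ** \<beta> - \<alpha> ** ?t \<Delta> - \<Delta> ** ?t \<beta>) $ i $ j)"
        unfolding comm[symmetric] by (simp add: norm_mult dist_norm norm_minus_commute del: complex_cnj_diff)
      also have "\<dots> \<le> norm (?t \<alpha> ** \<Delta> + ?t \<Delta> ** \<beta> - \<alpha> ** ?t \<Delta> - \<Delta> ** ?t \<beta>)"
        by (rule norm_entry_le)
      also have "\<dots> \<le> norm (?t \<alpha> ** \<Delta>) + norm (?t \<Delta> ** \<beta>) + norm (\<alpha> ** ?t \<Delta>) + norm (\<Delta> ** ?t \<beta>)"
        by (meson norm_triangle_ineq norm_triangle_ineq4 order_trans add_mono order_refl)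
      also have "\<dots> \<le> x * N + x * N + x * N + x * N"
      proof -
        have *: "norm (A ** B) \<le> x * N" if "norm A * norm B \<le> x * N" for A B :: "complex^'n^'n"
          using norm_matrix_mult_le[of A B] that by linarith
        have "norm \<alpha> * N \<le> x * N" "norm \<beta> * N \<le> x * N"
          using x N0 by (auto simp: \<alpha>_def \<beta>_def intro: mult_right_mono)
        then show ?thesis by (intro add_mono *) (auto simp: N_def mult.commute)
      qed
      finally have "dist (d i) (d j) * norm (\<Delta> $ i $ j) \<le> 4 * x * N" by (simp add: mult_ac)
      moreover have "\<delta> * norm (\<Delta> $ i $ j) \<le> dist (d i) (d j) * norm (\<Delta> $ i $ j)"
        using \<delta>(2)[OF ij] by (intro mult_right_mono) auto
      ultimately have "\<delta> * norm (\<Delta> $ i $ j) \<le> 4 * x * N" by linarith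
      then show ?thesis using \<delta>(1) by (simp add: field_simps)
    qed
    have all: "norm (\<Delta> $ i $ j) \<le> (5 * C1 + 4 / \<delta>) * x * N" for i j
    proof -
      have "0 \<le> 5 * C1 * x * N" "0 \<le> 4 / \<delta> * x * N" using C1 \<delta> x N0 by auto
      then show ?thesis using same[of i j] off[of i j] by (cases "d i = d j") (auto simp: algebra_simps)
    qed
    have "N \<le> K * ((5 * C1 + 4 / \<delta>) * x * N)"
      unfolding N_def K_def by (rule norm_matrix_le_entries) (use all in \<open>simp add: N_def\<close>)
    also have "\<dots> = (K * (5 * C1 + 4 / \<delta>) * x) * N" by simp
    also have "\<dots> \<le> 1 / 2 * N" using Cx(3) N0 by (intro mult_right_mono)
    finally have "N = 0" using N0 by simp
    then show ?thesis by (simp add: N_def \<Delta>_def)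
  qed
  show ?thesis using that[OF \<epsilon>] main by blast
qed

subsection \<open>The Cayley transform\<close>

lemma norm_matrix_mono:
  fixes A B :: "complex^'n^'m"
  assumes "\<And>i j. norm (A $ i $ j) \<le> norm (B $ i $ j)"
  shows "norm A \<le> norm B"
  unfolding norm_vec_def by (intro L2_set_mono assms) (auto simp: L2_set_nonneg)

lemma continuous_on_matrix_mult [continuous_intros]:
  fixes f g :: "'a::topological_space \<Rightarrow> complex^'n^'n"
  assumes "continuous_on S f" "continuous_on S g"
  shows "continuous_on S (\<lambda>x. f x ** g x)"
  unfolding matrix_matrix_mult_def using assms by (intro continuous_intros)

lemma continuous_on_conj_transpose [continuous_intros]:
  fixes f :: "'a::topological_space \<Rightarrow> complex^'n^'m"
  assumes "continuous_on S f"
  shows "continuous_on S (\<lambda>x. conj_transpose (f x))"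
  unfolding conj_transpose_def map_matrix_def transpose_def
  using assms by (auto intro!: continuous_intros)

lemma continuous_on_diag_matrix [continuous_intros]:
  fixes f :: "'a::topological_space \<Rightarrow> 'n::finite \<Rightarrow> complex"
  assumes "\<And>i. continuous_on S (\<lambda>x. f x i)"
  shows "continuous_on S (\<lambda>x. diag_matrix (f x))"
  unfolding diag_matrix_def
proof (intro continuous_on_vec_lambda)
  show "continuous_on S (\<lambda>x. if i = j then f x i else 0)" for i j
    by (cases "i = j") (auto intro: assms)
qed

text \<open>A kernel vector satisfies X v = -v, which is impossible for nonzero \<open>v\<close>
  when the norm of \<open>X\<close> is below 1.\<close>

lemma one_plus_inverse:
  fixes X :: "complex^'n^'n"
  assumes X: "norm X < 1"
  shows "(mat 1 + X) ** matrix_inv (mat 1 + X) = mat 1"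
    and "matrix_inv (mat 1 + X) ** (mat 1 + X) = mat 1"
proof -
  have ker: "v = 0" if v: "(mat 1 + X) *v v = 0" for v
  proof -
    \<comment> \<open>All columns equal \<open>v\<close>, so that the inequality for products of
      square matrices applies to a vector.\<close>
    define M :: "complex^'n^'n" where "M = (\<chi> i j. v $ i)"
    have "(X *v v) $ i = - v $ i" for i
    proof -
      have "((mat 1 + X) *v v) $ i = v $ i + (X *v v) $ i"
        by (simp add: matrix_vector_mult_add_rdistrib)
      then show ?thesis using v by (simp add: eq_neg_iff_add_eq_0 add.commute)
    qed
    then have "X ** M = - M"
      by (simp add: vec_eq_iff M_def matrix_matrix_mult_def matrix_vector_mult_def)
    then have "norm M \<le> norm X * norm M" using norm_matrix_mult_le[of X M] by simp
    then have "(1 - norm X) * norm M \<le> 0" by (simp add: algebra_simps)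
    then have "M = 0" using X by (simp add: mult_le_0_iff)
    then show "v = 0" by (simp add: M_def vec_eq_iff)
  qed
  then have "\<exists>B. B ** (mat 1 + X) = mat 1"
    using matrix_left_invertible_ker by blast
  then obtain B where B: "B ** (mat 1 + X) = mat 1" by blast
  then have "(mat 1 + X) ** B = mat 1" using matrix_left_right_inverse by blast
  with B have "\<exists>B. (mat 1 + X) ** B = mat 1 \<and> B ** (mat 1 + X) = mat 1" by blast
  then have "(mat 1 + X) ** matrix_inv (mat 1 + X) = mat 1 \<and> matrix_inv (mat 1 + X) ** (mat 1 + X) = mat 1"
    unfolding matrix_inv_def by (rule someI_ex)
  then show "(mat 1 + X) ** matrix_inv (mat 1 + X) = mat 1"
    and "matrix_inv (mat 1 + X) ** (mat 1 + X) = mat 1" by auto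
qed

text \<open>A rational substitute for the exponential map from skew-Hermitian to unitary
  matrices.\<close>

definition cayley :: "complex^'n^'n \<Rightarrow> complex^'n^'n" where
  "cayley X = (mat 1 - X) ** matrix_inv (mat 1 + X)"

lemma cayley_mult_right: "norm X < 1 \<Longrightarrow> cayley X ** (mat 1 + X) = mat 1 - X"
  unfolding cayley_def by (simp add: matrix_mul_assoc[symmetric] one_plus_inverse(2))

lemma cayley_mult_left:
  assumes "norm X < 1"
  shows "(mat 1 + X) ** cayley X = mat 1 - X"
proof -
  have "(mat 1 + X) ** (mat 1 - X) = (mat 1 - X) ** (mat 1 + X)"
    by (simp add: matrix_mult_distribs)
  then have "(mat 1 + X) ** cayley X = (mat 1 - X) ** ((mat 1 + X) ** matrix_inv (mat 1 + X))"
    unfolding cayley_def by (simp add: matrix_mul_assoc)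
  then show ?thesis by (simp add: one_plus_inverse(1)[OF assms])
qed

text \<open>Taking adjoints exchanges \<open>mat 1 + X\<close> and \<open>mat 1 - X\<close>, and
  these two commute.\<close>

lemma unitary_cayley:
  fixes X :: "complex^'n^'n"
  assumes X: "norm X < 1" "conj_transpose X = - X"
  shows "unitary_matrix (cayley X)"
proof -
  let ?Z = "matrix_inv (mat 1 + X)"
  have "conj_transpose ((mat 1 + X) ** ?Z) = mat 1" by (simp add: one_plus_inverse(1)[OF X(1)])
  then have Z: "conj_transpose ?Z ** (mat 1 - X) = mat 1"
    by (simp add: conj_transpose_matrix_mult conj_transpose_add X(2))
  have "conj_transpose (cayley X) = conj_transpose ?Z ** (mat 1 + X)"
    by (simp add: cayley_def conj_transpose_matrix_mult conj_transpose_diff X(2))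
  then have "conj_transpose (cayley X) ** cayley X
      = conj_transpose ?Z ** ((mat 1 + X) ** (mat 1 - X)) ** ?Z"
    by (simp only: cayley_def matrix_mul_assoc)
  also have "(mat 1 + X) ** (mat 1 - X) = (mat 1 - X) ** (mat 1 + X)"
    by (simp add: matrix_mult_distribs)
  also have "conj_transpose ?Z ** \<dots> ** ?Z
      = (conj_transpose ?Z ** (mat 1 - X)) ** ((mat 1 + X) ** ?Z)"
    by (simp only: matrix_mul_assoc)
  also have "\<dots> = mat 1" by (simp add: Z one_plus_inverse(1)[OF X(1)])
  finally show ?thesis by (simp add: unitary_matrix_def)
qed

text \<open>On a ball of radius below 1 the inverse \<open>h\<close> is bounded, by
  \<open>h X = mat 1 - X ** h X\<close>. The resolvent identity
  \<open>h X - h Y = h X ** (Y - X) ** h Y\<close> then makes it Lipschitz.\<close>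

lemma continuous_on_cayley:
  fixes f :: "'a::topological_space \<Rightarrow> complex^'n^'n"
  assumes f: "continuous_on S f" and r: "r < 1" "\<And>x. x \<in> S \<Longrightarrow> norm (f x) \<le> r"
  shows "continuous_on S (\<lambda>x. cayley (f x))"
proof -
  define h :: "complex^'n^'n \<Rightarrow> complex^'n^'n" where "h X = matrix_inv (mat 1 + X)" for X
  define M where "M = norm (mat 1 :: complex^'n^'n) / (1 - r)"
  have M0: "M \<ge> 0" using r by (simp add: M_def)
  have inv: "(mat 1 + X) ** h X = mat 1" "h X ** (mat 1 + X) = mat 1" if "X \<in> cball 0 r" for X :: "complex^'n^'n"
    using one_plus_inverse[of X] that r by (auto simp: h_def)
  have hM: "norm (h X) \<le> M" if X: "X \<in> cball 0 r" for X :: "complex^'n^'n"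
  proof -
    have "h X = mat 1 - X ** h X"
      using inv(1)[OF X] by (simp add: matrix_mult_distribs eq_diff_eq)
    then have "norm (h X) \<le> norm (mat 1 :: complex^'n^'n) + norm (X ** h X)"
      by (metis norm_triangle_ineq4)
    also have "norm (X ** h X) \<le> norm X * norm (h X)" by (rule norm_matrix_mult_le)
    also have "\<dots> \<le> r * norm (h X)" using X by (intro mult_right_mono) auto
    finally have "(1 - r) * norm (h X) \<le> norm (mat 1 :: complex^'n^'n)" by (simp add: algebra_simps)
    then show ?thesis using r by (simp add: M_def field_simps)
  qed
  have "lipschitz_on (M * M) (cball 0 r) h"
  proof (rule lipschitz_onI)
    fix X Y :: "complex^'n^'n" assume X: "X \<in> cball 0 r" and Y: "Y \<in> cball 0 r"
    have "h X ** (Y - X) ** h Y = h X ** ((mat 1 + Y) ** h Y) - (h X ** (mat 1 + X)) ** h Y"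
      by (simp add: matrix_mult_distribs matrix_mul_assoc)
    then have eq: "h X - h Y = h X ** (Y - X) ** h Y"
      by (simp add: inv(1)[OF Y] inv(2)[OF X])
    have "norm (h X ** (Y - X)) \<le> M * norm (Y - X)"
      using norm_matrix_mult_le[of "h X" "Y - X"] hM[OF X]
      by (meson mult_right_mono norm_ge_zero order_trans)
    then have "norm (h X ** (Y - X)) * norm (h Y) \<le> (M * norm (Y - X)) * M"
      using hM[OF Y] M0 by (intro mult_mono) auto
    then have "norm (h X - h Y) \<le> (M * norm (Y - X)) * M"
      unfolding eq using norm_matrix_mult_le[of "h X ** (Y - X)" "h Y"] by linarith
    then show "dist (h X) (h Y) \<le> M * M * dist X Y"
      by (simp add: dist_norm norm_minus_commute mult_ac)
  qed (use M0 in simp)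
  then have "continuous_on (cball 0 r) h" by (rule lipschitz_on_continuous_on)
  then have "continuous_on S (\<lambda>x. h (f x))"
    by (rule continuous_on_compose2) (use f r in auto)
  then show ?thesis
    unfolding cayley_def h_def[symmetric] using f by (intro continuous_intros)
qed

text \<open>The unitary \<open>V\<close> comparing the two Cayley transforms intertwines the
  diagonal matrices. Separation of the values makes it block diagonal for the fibres of
  \<open>d\<close>, while \<open>X\<close> and \<open>Y\<close> vanish on the diagonal blocks. These
  two facts together force \<open>V\<close> to be the identity.\<close>

lemma cayley_conj_injective:
  fixes X Y :: "complex^'n^'n" and d :: "'n \<Rightarrow> complex"
  assumes X: "norm X < 1" "conj_transpose X = - X" "\<And>i j. d i = d j \<Longrightarrow> X $ i $ j = 0"
    and Y: "norm Y < 1" "conj_transpose Y = - Y" "\<And>i j. d i = d j \<Longrightarrow> Y $ i $ j = 0"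
    and \<mu>: "\<And>i j. d i = d j \<Longrightarrow> \<mu> i = \<mu> j"
    and sep: "\<And>i j. d i \<noteq> d j \<Longrightarrow> \<nu> i \<noteq> \<mu> j"
    and eq: "cayley X ** diag_matrix \<mu> ** conj_transpose (cayley X)
           = cayley Y ** diag_matrix \<nu> ** conj_transpose (cayley Y)"
  shows "X = Y" "\<mu> = \<nu>"
proof -
  define U where "U = cayley X"
  define u where "u = cayley Y"
  have U: "unitary_matrix U" and u: "unitary_matrix u"
    using unitary_cayley X Y by (auto simp: U_def u_def)
  define V where "V = conj_transpose u ** U"
  have V: "unitary_matrix V"
    unfolding V_def by (intro unitary_matrix_mult unitary_matrix_conj_transpose U u)
  have "V ** diag_matrix \<mu>
      = conj_transpose u ** (U ** diag_matrix \<mu> ** conj_transpose U) ** U"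
    unfolding V_def by (simp add: matrix_mul_assoc[symmetric] unitary_matrixD(1)[OF U])
  also have "\<dots> = diag_matrix \<nu> ** V"
    unfolding eq[folded U_def u_def] V_def
    by (simp add: matrix_mul_assoc unitary_matrixD(1)[OF u])
  finally have comm: "V $ i $ j * \<mu> j = \<nu> i * V $ i $ j" for i j
    by (metis diag_matrix_mult_left diag_matrix_mult_right)
  have Vblock: "V $ i $ j = 0" if "d i \<noteq> d j" for i j
    using comm[of i j] sep[OF that] by (auto simp: mult.commute)
  show "\<mu> = \<nu>"
  proof
    \<comment> \<open>Row \<open>i\<close> of \<open>V\<close> has a nonzero entry, necessarily
      inside the block of \<open>i\<close>; there the intertwining relation equates the two
      values.\<close>
    fix i
    obtain k where k: "norm (V $ i $ k) \<ge> 1 / real CARD('n)"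
      by (rule unitary_matrix_row_large_entry[OF V])
    have "0 < 1 / real CARD('n)" by simp
    then have V0: "V $ i $ k \<noteq> 0" using k by auto
    then have "d i = d k" using Vblock by blast
    then show "\<mu> i = \<nu> i" using \<mu>[of i k] comm[of i k] V0 by simp
  qed
  have uV: "u ** V = U"
    unfolding V_def by (simp add: matrix_mul_assoc unitary_matrixD(2)[OF u])
  have "(mat 1 - Y) ** V ** (mat 1 + X) = (mat 1 + Y) ** (u ** V) ** (mat 1 + X)"
    unfolding cayley_mult_left[OF Y(1), symmetric] u_def by (simp add: matrix_mul_assoc)
  also have "\<dots> = (mat 1 + Y) ** (mat 1 - X)"
    unfolding uV unfolding U_def by (simp add: matrix_mul_assoc[symmetric] cayley_mult_right[OF X(1)])
  finally have key: "(mat 1 - Y) ** V ** (mat 1 + X) = (mat 1 + Y) ** (mat 1 - X)" .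
  define W where "W = V - mat 1"
  \<comment> \<open>The last two brackets vanish on the diagonal blocks, and \<open>W\<close>
    vanishes off them. Hence \<open>W\<close> is entrywise dominated by \<open>Y ** W ** X\<close>,
    a contraction since both norms are below 1.\<close>
  have W: "W = Y ** W ** X + (Y - X) + (Y ** V - V ** X)"
    using key by (simp add: W_def matrix_mult_distribs algebra_simps)
  have "norm (W $ i $ j) \<le> norm ((Y ** W ** X) $ i $ j)" for i j
  proof (cases "d i = d j")
    case True
    have *: "V $ i $ k * X $ k $ j = 0" "Y $ i $ k * V $ k $ j = 0" for k
      using Vblock[of i k] Vblock[of k j] X(3)[of k j] Y(3)[of i k] True by force+
    have "(V ** X) $ i $ j = 0" "(Y ** V) $ i $ j = 0"
      by (simp_all only: matrix_matrix_mult_def vec_lambda_beta * sum.neutral_const)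
    moreover have "W $ i $ j = (Y ** W ** X) $ i $ j + (Y $ i $ j - X $ i $ j)
        + ((Y ** V) $ i $ j - (V ** X) $ i $ j)"
      by (subst W) simp
    ultimately have "W $ i $ j = (Y ** W ** X) $ i $ j"
      using X(3)[OF True] Y(3)[OF True] by simp
    then show ?thesis by simp
  next
    case False
    then show ?thesis using Vblock[OF False] by (auto simp: W_def mat_def)
  qed
  then have "norm W \<le> norm (Y ** W ** X)" by (rule norm_matrix_mono)
  also have "\<dots> \<le> norm Y * norm W * norm X"
    by (meson norm_matrix_mult_le mult_right_mono norm_ge_zero order_trans)
  finally have "(1 - norm Y * norm X) * norm W \<le> 0" by (simp add: algebra_simps)
  moreover have "norm Y * norm X < 1"
    using X(1) Y(1) by (metis mult_strict_mono' norm_ge_zero mult_1)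
  ultimately have "W = 0" by (simp add: mult_le_0_iff)
  then have "V = mat 1" by (simp add: W_def)
  then have "mat 1 + X - Y - Y ** X = mat 1 - X + Y - Y ** X"
    using key by (simp add: matrix_mult_distribs algebra_simps)
  then have "2 *\<^sub>R X = 2 *\<^sub>R Y" by (simp add: scaleR_2 algebra_simps)
  then show "X = Y" by simp
qed

subsection \<open>Charts\<close>

text \<open>A real basis of the matrices supported on \<open>L\<close>: each position contributes
  its matrix unit and \<open>\<i>\<close> times it.\<close>

definition coordinate_matrices :: "('n \<times> 'n) set \<Rightarrow> (complex^'n^'n) set" where
  "coordinate_matrices L = (\<lambda>((i, j), c). axis i (axis j c)) ` (L \<times> {1, \<i>})"

lemma coordinate_matrices_subset_Basis: "coordinate_matrices L \<subseteq> Basis"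
  by (auto simp: coordinate_matrices_def Basis_vec_def Basis_complex_def)

lemma card_coordinate_matrices:
  fixes L :: "('n::finite \<times> 'n) set"
  shows "card (coordinate_matrices L) = 2 * card L"
proof -
  have "inj_on (\<lambda>((i, j), c). axis i (axis j c) :: complex^'n^'n) (L \<times> {1, \<i>})"
    by (auto simp: inj_on_def axis_eq_axis axis_eq_0_iff)
  then have "card (coordinate_matrices L) = card (L \<times> {1, \<i>})"
    unfolding coordinate_matrices_def by (rule card_image)
  then show ?thesis by (simp add: card_cartesian_product)
qed

lemma span_coordinate_matrices:
  fixes M :: "complex^'n^'n"
  shows "M \<in> span (coordinate_matrices L) \<longleftrightarrow> (\<forall>i j. (i, j) \<notin> L \<longrightarrow> M $ i $ j = 0)"
proof -
  have inner: "M \<bullet> axis i (axis j c) = (M $ i $ j) \<bullet> c" for i j c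
    by (simp add: inner_axis)
  have zero: "x = 0 \<longleftrightarrow> x \<bullet> 1 = 0 \<and> x \<bullet> \<i> = 0" for x :: complex
    by (simp add: complex_eq_iff inner_complex_def)
  have mem: "axis i (axis j c) \<in> coordinate_matrices L \<longleftrightarrow> (i, j) \<in> L" if "c \<in> {1, \<i>}" for i j c
  proof
    assume "axis i (axis j c) \<in> coordinate_matrices L"
    then obtain i' j' c' where "(i', j') \<in> L" "axis i (axis j c) = (axis i' (axis j' c') :: complex^'n^'n)"
      unfolding coordinate_matrices_def by auto
    then show "(i, j) \<in> L"
      using that by (auto simp: axis_eq_axis axis_eq_0_iff)
  qed (use that in \<open>force simp: coordinate_matrices_def\<close>)
  have "M \<in> span (coordinate_matrices L) \<longleftrightarrow>
      (\<forall>b\<in>Basis. b \<notin> coordinate_matrices L \<longrightarrow> M \<bullet> b = 0)"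
    by (simp add: span_substd_basis[OF coordinate_matrices_subset_Basis])
  also have "\<dots> \<longleftrightarrow> (\<forall>i j. \<forall>c\<in>{1, \<i>}. (i, j) \<notin> L \<longrightarrow> (M $ i $ j) \<bullet> c = 0)"
    using mem by (auto simp: Basis_vec_def Basis_complex_def inner)
  also have "\<dots> \<longleftrightarrow> (\<forall>i j. (i, j) \<notin> L \<longrightarrow> M $ i $ j = 0)"
    using zero by auto
  finally show ?thesis .
qed

section \<open>The chart space and its dimension\<close>

lemma exists_tournament:
  fixes d :: "'n::finite \<Rightarrow> 'b"
  obtains L where "\<And>i j. d i \<noteq> d j \<Longrightarrow> (i, j) \<in> L \<or> (j, i) \<in> L"
    "\<And>i j. (i, j) \<in> L \<Longrightarrow> d i \<noteq> d j \<and> (j, i) \<notin> L"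
    "2 * card L + card {(i, j). d i = d j} = (CARD('n))\<^sup>2"
proof -
  obtain f :: "'n \<Rightarrow> nat" where f: "inj f"
    using finite_imp_inj_to_nat_seg[of "UNIV :: 'n set"] by auto
  \<comment> \<open>Numbering the indices orients each pair upwards. Then \<open>L\<close>, its
    converse and the pairs within a fibre partition all index pairs.\<close>
  define L where "L = {(i, j). d i \<noteq> d j \<and> f i < f j}"
  have tot: "(i, j) \<in> L \<or> (j, i) \<in> L" if "d i \<noteq> d j" for i j
  proof -
    have "f i \<noteq> f j" using that f by (auto simp: inj_def)
    then show ?thesis using that by (auto simp: L_def)
  qed
  have anti: "d i \<noteq> d j \<and> (j, i) \<notin> L" if "(i, j) \<in> L" for i j
    using that by (auto simp: L_def)
  let ?E = "{(i, j). d i = d j}"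
  have "card (L\<inverse>) = card L" by (simp add: card_inverse)
  moreover have "card ((L \<union> L\<inverse>) \<union> ?E) = card L + card (L\<inverse>) + card ?E"
  proof -
    have "L \<inter> L\<inverse> = {}" using anti by auto
    moreover have "(L \<union> L\<inverse>) \<inter> ?E = {}" using anti by fastforce
    ultimately have "L \<inter> L\<inverse> = {}" "(L \<union> L\<inverse>) \<inter> ?E = {}" .
    then show ?thesis by (simp add: card_Un_disjoint)
  qed
  moreover have "(L \<union> L\<inverse>) \<union> ?E = (UNIV :: ('n \<times> 'n) set)"
    using tot by auto
  moreover have "card (UNIV :: ('n \<times> 'n) set) = (CARD('n))\<^sup>2"
    by (simp add: power2_eq_square)
  ultimately have "2 * card L + card ?E = (CARD('n))\<^sup>2" by simp
  then show ?thesis using that tot anti by blast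
qed

text \<open>Such pairs form the disjoint union of the squares of the fibres; this is the source of
  the sum of squares in the dimension formula.\<close>

lemma card_fibre_pairs:
  fixes d :: "'n::finite \<Rightarrow> 'b"
  assumes e: "bij_betw e J (range d)" and k: "\<And>i. i \<in> J \<Longrightarrow> card {j. d j = e i} = k i" and "finite J"
  shows "card {(i, j). d i = d j} = (\<Sum>i\<in>J. (k i)\<^sup>2)"
proof -
  have "{(i, j). d i = d j} = (\<Union>i\<in>J. {j. d j = e i} \<times> {j. d j = e i})"
  proof (intro equalityI subrelI)
    fix a b assume "(a, b) \<in> {(i, j). d i = d j}"
    moreover have "d a \<in> e ` J" using e by (auto simp: bij_betw_def)
    ultimately show "(a, b) \<in> (\<Union>i\<in>J. {j. d j = e i} \<times> {j. d j = e i})" by auto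
  qed auto
  also have "card \<dots> = (\<Sum>i\<in>J. card ({j. d j = e i} \<times> {j. d j = e i}))"
    using assms by (intro card_UN_disjoint) (auto simp: bij_betw_def inj_on_def)
  also have "\<dots> = (\<Sum>i\<in>J. (k i)\<^sup>2)"
    by (simp add: card_cartesian_product k power2_eq_square)
  finally show ?thesis .
qed

lemma card_range_section:
  fixes d :: "'n::finite \<Rightarrow> 'b"
  shows "card (inv_into UNIV d ` range d) = card (range d)"
  by (intro card_image inj_on_inv_into) simp

text \<open>The free complex entries are those at \<open>L\<close> and at one diagonal position per
  fibre, chosen by \<open>inv_into UNIV d\<close>. Each counts twice over the reals, and
  \<open>2 * card L\<close> is the number of all index pairs minus that of the pairs within
  fibres.\<close>

lemma chart_space:
  fixes d :: "'n::finite \<Rightarrow> complex"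
  assumes e: "bij_betw e {1..I} (range d)" and k: "\<And>i. i \<in> {1..I} \<Longrightarrow> card {j. d j = e i} = k i"
  obtains L B where "\<And>i j. d i \<noteq> d j \<Longrightarrow> (i, j) \<in> L \<or> (j, i) \<in> L"
    "\<And>i j. (i, j) \<in> L \<Longrightarrow> d i \<noteq> d j \<and> (j, i) \<notin> L"
    "independent B" "pairwise orthogonal B" "\<And>u. u \<in> B \<Longrightarrow> norm u = 1"
    "\<And>M :: complex^'n^'n. M \<in> span B \<longleftrightarrow>
       (\<forall>i j. (i, j) \<notin> L \<and> \<not> (i = j \<and> i \<in> inv_into UNIV d ` range d) \<longrightarrow> M $ i $ j = 0)"
    "int (card B) = (int CARD('n))\<^sup>2 - (\<Sum>i=1..I. (int (k i))\<^sup>2) + 2 * int I"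
proof -
  obtain L where L: "\<And>i j. d i \<noteq> d j \<Longrightarrow> (i, j) \<in> L \<or> (j, i) \<in> L"
    "\<And>i j. (i, j) \<in> L \<Longrightarrow> d i \<noteq> d j \<and> (j, i) \<notin> L"
    "2 * card L + card {(i, j). d i = d j} = (CARD('n))\<^sup>2"
    using exists_tournament[of d] by blast
  define R where "R = inv_into UNIV d ` range d"
  define L' where "L' = L \<union> (\<lambda>r. (r, r)) ` R"
  define B :: "(complex^'n^'n) set" where "B = coordinate_matrices L'"
  have sub: "B \<subseteq> Basis" unfolding B_def by (rule coordinate_matrices_subset_Basis)
  have cR: "card R = I"
    using bij_betw_same_card[OF e] by (simp add: R_def card_range_section)
  have "card L' = card L + card ((\<lambda>r. (r, r)) ` R)"
    unfolding L'_def using L(2) by (intro card_Un_disjoint) auto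
  also have "card ((\<lambda>r. (r, r)) ` R) = I"
    by (subst card_image) (auto simp: cR inj_on_def)
  finally have "card B = 2 * card L + 2 * I" by (simp add: B_def card_coordinate_matrices)
  moreover have "2 * card L + (\<Sum>i=1..I. (k i)\<^sup>2) = (CARD('n))\<^sup>2"
    using L(3) card_fibre_pairs[OF e k] by simp
  then have "int (2 * card L + (\<Sum>i=1..I. (k i)\<^sup>2)) = int ((CARD('n))\<^sup>2)" by simp
  then have "2 * int (card L) + (\<Sum>i=1..I. (int (k i))\<^sup>2) = (int CARD('n))\<^sup>2" by simp
  ultimately have card: "int (card B) = (int CARD('n))\<^sup>2 - (\<Sum>i=1..I. (int (k i))\<^sup>2) + 2 * int I"
    by simp
  show ?thesis
  proof (rule that[OF L(1,2) _ _ _ _ card])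
    show "independent B" using sub independent_mono[OF independent_Basis] by blast
    show "pairwise orthogonal B"
      using sub by (auto simp: pairwise_def orthogonal_def inner_Basis subset_iff)
    show "norm u = 1" if "u \<in> B" for u using that sub norm_Basis by blast
    show "M \<in> span B \<longleftrightarrow>
       (\<forall>i j. (i, j) \<notin> L \<and> \<not> (i = j \<and> i \<in> inv_into UNIV d ` range d) \<longrightarrow> M $ i $ j = 0)" for M
      unfolding B_def span_coordinate_matrices L'_def R_def by blast
  qed auto
qed

section \<open>Upper bound: manifolds inside the set of normal matrices\<close>

lemma normal_with_multsE:
  fixes A :: "complex^'n^'n"
  assumes "A \<in> normal_with_mults I k"
  obtains U d e where "unitary_matrix U" "A = U ** diag_matrix d ** conj_transpose U"
    "bij_betw e {1..I} (range d)" "\<And>i. i \<in> {1..I} \<Longrightarrow> card {j. d j = e i} = k i"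
proof -
  have "normal_matrix A" using assms by (simp add: normal_with_mults_def)
  then obtain U d where U: "unitary_matrix U" "A = U ** diag_matrix d ** conj_transpose U"
    by (rule normal_matrix_unitarily_diagonalizable)
  then show ?thesis
    using assms that unitary_conj_in_normal_with_mults_iff[OF U(1)] by metis
qed

lemma manifold_dim_le_normal_with_mults:
  fixes T :: "(complex^'n^'n) set"
  assumes T: "T \<subseteq> normal_with_mults I k" "T \<noteq> {}" "manifold_of_dim m T"
  shows "int m \<le> (int CARD('n))\<^sup>2 - (\<Sum>i=1..I. (int (k i))\<^sup>2) + 2 * int I"
proof -
  obtain A0 where A0: "A0 \<in> T" using T(2) by blast
  then have "A0 \<in> normal_with_mults I k" using T(1) by blast
  then obtain U d e where U: "unitary_matrix U" and A0d: "A0 = U ** diag_matrix d ** conj_transpose U"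
    and e: "bij_betw e {1..I} (range d)" and k: "\<And>i. i \<in> {1..I} \<Longrightarrow> card {j. d j = e i} = k i"
    by (rule normal_with_multsE) (rule that)
  obtain L B where L: "\<And>i j. d i \<noteq> d j \<Longrightarrow> (i, j) \<in> L \<or> (j, i) \<in> L"
    "\<And>i j. (i, j) \<in> L \<Longrightarrow> d i \<noteq> d j \<and> (j, i) \<notin> L"
    and B: "independent B" "pairwise orthogonal B" "\<And>u. u \<in> B \<Longrightarrow> norm u = 1"
    and span: "\<And>M :: complex^'n^'n. M \<in> span B \<longleftrightarrow>
       (\<forall>i j. (i, j) \<notin> L \<and> \<not> (i = j \<and> i \<in> inv_into UNIV d ` range d) \<longrightarrow> M $ i $ j = 0)"
    and card: "int (card B) = (int CARD('n))\<^sup>2 - (\<Sum>i=1..I. (int (k i))\<^sup>2) + 2 * int I"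
    by (rule chart_space[OF e k]) (assumption, rule that)
  define R where "R = inv_into UNIV d ` range d"
  have R: "\<exists>r\<in>R. d r = d i" for i
    unfolding R_def by (rule bexI[of _ "inv_into UNIV d (d i)"]) (auto simp: f_inv_into_f)
  obtain \<epsilon> where \<epsilon>: "\<epsilon> > 0" and det:
    "\<And>a b. normal_matrix a \<Longrightarrow> card (eigenvalues a) = card (range d) \<Longrightarrow>
       normal_matrix b \<Longrightarrow> card (eigenvalues b) = card (range d) \<Longrightarrow>
       norm (a - diag_matrix d) < \<epsilon> \<Longrightarrow> norm (b - diag_matrix d) < \<epsilon> \<Longrightarrow>
       (\<And>i j. (i, j) \<in> L \<Longrightarrow> a $ i $ j = b $ i $ j) \<Longrightarrow>
       (\<And>r. r \<in> R \<Longrightarrow> a $ r $ r = b $ r $ r) \<Longrightarrow> a = b"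
    by (rule normal_matrix_locally_determined[OF L(1) R]) (assumption, rule that, assumption, blast)
  \<comment> \<open>The rotation \<open>s\<close> moves the base point \<open>A0\<close> to
    \<open>diag_matrix d\<close>; \<open>f\<close> then keeps the chart entries and is the local
    injection to which invariance of domain applies.\<close>
  define s where "s A = conj_transpose U ** A ** U" for A
  define f :: "complex^'n^'n \<Rightarrow> complex^'n^'n" where
    "f A = (\<chi> i j. if (i, j) \<in> L \<or> (i = j \<and> i \<in> R) then s A $ i $ j else 0)" for A
  define N where "N = {A. norm (s A - diag_matrix d) < \<epsilon>}"
  have cs: "continuous_on S s" for S
    unfolding s_def by (intro continuous_intros)
  have "open N"
    unfolding N_def by (intro open_Collect_less continuous_intros cs)
  moreover have "A0 \<in> N"
  proof -
    have "s A0 = (conj_transpose U ** U) ** diag_matrix d ** (conj_transpose U ** U)"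
      by (simp only: s_def A0d matrix_mul_assoc)
    then show ?thesis using \<epsilon> by (simp add: N_def unitary_matrixD(1)[OF U])
  qed
  moreover have "continuous_on (T \<inter> N) f"
    unfolding f_def
  proof (intro continuous_on_vec_lambda)
    show "continuous_on (T \<inter> N) (\<lambda>A. if (i, j) \<in> L \<or> (i = j \<and> i \<in> R) then s A $ i $ j else 0)" for i j
      by (cases "(i, j) \<in> L \<or> (i = j \<and> i \<in> R)", simp_all only: if_True if_False)
        (intro continuous_intros cs)+
  qed
  moreover have "f A \<in> span B" for A
    unfolding span f_def R_def[symmetric] by simp
  then have "f ` (T \<inter> N) \<subseteq> span B" by blast
  moreover have "inj_on f (T \<inter> N)"
  proof (rule inj_onI)
    \<comment> \<open>Rotation preserves normality and the spectrum, so all of \<open>T\<close> has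
      the same number of distinct eigenvalues after it.\<close>
    have sA: "normal_matrix (s A)" "card (eigenvalues (s A)) = card (range d)" if "A \<in> T" for A
    proof -
      have "A \<in> normal_with_mults I k" using T(1) that by blast
      then obtain W c e' where W: "unitary_matrix W" "A = W ** diag_matrix c ** conj_transpose W"
        and e': "bij_betw e' {1..I} (range c)"
        by (rule normal_with_multsE) (rule that)
      define V where "V = conj_transpose U ** W"
      have V: "unitary_matrix V"
        unfolding V_def by (intro unitary_matrix_mult unitary_matrix_conj_transpose U W)
      have s: "s A = V ** diag_matrix c ** conj_transpose V"
        unfolding s_def W(2) V_def by (simp add: conj_transpose_matrix_mult matrix_mul_assoc)
      show "normal_matrix (s A)" unfolding s by (rule normal_unitary_conj[OF V])
      show "card (eigenvalues (s A)) = card (range d)"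
        unfolding s eigenvalues_unitary_conj[OF V]
        using bij_betw_same_card[OF e'] bij_betw_same_card[OF e] by simp
    qed
    fix A A' assume A: "A \<in> T \<inter> N" and A': "A' \<in> T \<inter> N" and eq: "f A = f A'"
    have fe: "f A $ i $ j = f A' $ i $ j" for i j using eq by simp
    have eqL: "s A $ i $ j = s A' $ i $ j" if "(i, j) \<in> L" for i j
      using fe[of i j] that by (simp add: f_def)
    have eqR: "s A $ r $ r = s A' $ r $ r" if "r \<in> R" for r
      using fe[of r r] that by (simp add: f_def)
    have "s A = s A'"
      by (rule det) (use A A' sA eqL eqR in \<open>auto simp: N_def\<close>)
    moreover have "U ** s M ** conj_transpose U = M" for M
    proof -
      have "U ** s M ** conj_transpose U = (U ** conj_transpose U) ** M ** (U ** conj_transpose U)"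
        by (simp only: s_def matrix_mul_assoc)
      then show ?thesis by (simp add: unitary_matrixD(2)[OF U])
    qed
    ultimately show "A = A'" by metis
  qed
  ultimately have "m \<le> card B"
    using manifold_dim_le_local_injection[OF T(3) A0 B] by blast
  then show ?thesis using card by simp
qed

section \<open>Lower bound: a manifold given by the Cayley transform\<close>

lemma exists_function_with_fibre_cards:
  assumes pos: "\<And>i. i \<in> {1..I} \<Longrightarrow> k i > 0" and sum: "(\<Sum>i=1..I. k i) = CARD('n)"
  obtains h :: "'n::finite \<Rightarrow> nat" where "range h = {1..I}" "\<And>i. i \<in> {1..I} \<Longrightarrow> card {j. h j = i} = k i"
proof -
  \<comment> \<open>The indices are identified with a disjoint union of blocks of sizes
    \<open>k i\<close>, and \<open>h\<close> is the block number. Positivity of \<open>k i\<close>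
    makes every number occur.\<close>
  let ?S = "SIGMA i:{1..I}. {..<k i}"
  have "card ?S = CARD('n)" using sum by simp
  then obtain b :: "'n \<Rightarrow> nat \<times> nat" where b: "bij_betw b UNIV ?S"
    using finite_same_card_bij[of "UNIV :: 'n set" ?S] by auto
  define h where "h = fst \<circ> b"
  have "range h = fst ` ?S" unfolding h_def image_comp[symmetric] using b by (simp add: bij_betw_def)
  also have "\<dots> = {1..I}"
  proof (intro equalityI subsetI)
    fix i assume i: "i \<in> {1..I}"
    then have "(i, 0) \<in> ?S" using pos by auto
    then show "i \<in> fst ` ?S" by force
  qed auto
  finally have range: "range h = {1..I}" .
  have "card {j. h j = i} = k i" if i: "i \<in> {1..I}" for i
  proof -
    have "b ` {j. h j = i} = {i} \<times> {..<k i}"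
    proof (intro equalityI subsetI)
      fix x assume x: "x \<in> {i} \<times> {..<k i}"
      then have "x \<in> b ` UNIV" using b i by (auto simp: bij_betw_def)
      then obtain j where "x = b j" by blast
      moreover from this have "h j = i" using x by (auto simp: h_def)
      ultimately show "x \<in> b ` {j. h j = i}" by blast
    next
      fix x assume "x \<in> b ` {j. h j = i}"
      then obtain j where "h j = i" "x = b j" by blast
      moreover have "b j \<in> ?S" using b by (auto simp: bij_betw_def)
      ultimately show "x \<in> {i} \<times> {..<k i}" by (auto simp: h_def)
    qed
    moreover have "card (b ` {j. h j = i}) = card {j. h j = i}"
      using b by (intro card_image) (auto simp: bij_betw_def inj_on_def)
    ultimately show ?thesis by simp
  qed
  then show ?thesis using that range by blast
qed

lemma exists_manifold_in_normal_with_mults: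
  assumes pos: "\<And>i. i \<in> {1..I} \<Longrightarrow> k i > 0" and sum: "(\<Sum>i=1..I. k i) = CARD('n::finite)"
  obtains T :: "(complex^'n^'n) set" and m where
    "T \<subseteq> normal_with_mults I k" "T \<noteq> {}" "manifold_of_dim m T"
    "int m = (int CARD('n))\<^sup>2 - (\<Sum>i=1..I. (int (k i))\<^sup>2) + 2 * int I"
proof -
  obtain h :: "'n \<Rightarrow> nat" where h: "range h = {1..I}" "\<And>i. i \<in> {1..I} \<Longrightarrow> card {j. h j = i} = k i"
    by (rule exists_function_with_fibre_cards[OF pos sum]) (assumption, rule that)
  define d :: "'n \<Rightarrow> complex" where "d = of_nat \<circ> h"
  have e: "bij_betw of_nat {1..I} (range d)"
    unfolding d_def image_comp[symmetric] h(1) by (auto simp: bij_betw_def inj_on_def)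
  have k: "card {j. d j = of_nat i} = k i" if "i \<in> {1..I}" for i
    using h(2)[OF that] by (simp add: d_def)
  obtain L B where L: "\<And>i j. d i \<noteq> d j \<Longrightarrow> (i, j) \<in> L \<or> (j, i) \<in> L"
    "\<And>i j. (i, j) \<in> L \<Longrightarrow> d i \<noteq> d j \<and> (j, i) \<notin> L"
    and B: "independent B" "pairwise orthogonal B" "\<And>u. u \<in> B \<Longrightarrow> norm u = 1"
    and span: "\<And>M :: complex^'n^'n. M \<in> span B \<longleftrightarrow>
       (\<forall>i j. (i, j) \<notin> L \<and> \<not> (i = j \<and> i \<in> inv_into UNIV d ` range d) \<longrightarrow> M $ i $ j = 0)"
    and card: "int (card B) = (int CARD('n))\<^sup>2 - (\<Sum>i=1..I. (int (k i))\<^sup>2) + 2 * int I"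
    by (rule chart_space[OF e k]) (assumption, rule that)
  obtain \<delta> where \<delta>: "\<delta> > 0" "\<And>i j. d i \<noteq> d j \<Longrightarrow> \<delta> \<le> dist (d i) (d j)"
    by (rule finite_range_gap[of d]) blast
  define K where "K = (real CARD('n))\<^sup>2"
  have K: "K \<ge> 1" by (simp add: K_def Suc_leI)
  \<comment> \<open>The first bound keeps the norm of \<open>X M\<close> at most 1/2. The second
    moves each eigenvalue by at most a third of the gap, so that two shifts cannot close it.\<close>
  define r where "r = min (1 / (2 * K)) (\<delta> / 3)"
  have r0: "r > 0" using K \<delta> by (simp add: r_def)
  have Kr: "K * r \<le> 1 / 2"
  proof -
    have "K * r \<le> K * (1 / (2 * K))" using K by (intro mult_left_mono) (auto simp: r_def)
    then show ?thesis using K by simp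
  qed
  have r\<delta>: "r \<le> \<delta> / 3" by (simp add: r_def)
  \<comment> \<open>The entries at \<open>L\<close> are free, the transposed ones are forced by
    skew-Hermitian symmetry, and the diagonal blocks are zero. Below, \<open>w\<close> shifts each
    eigenvalue by the diagonal entry at its representative, so \<open>\<mu> M\<close> is constant on
    the fibres of \<open>d\<close>.\<close>
  define X :: "complex^'n^'n \<Rightarrow> complex^'n^'n" where
    "X M = (\<chi> i j. if (i, j) \<in> L then M $ i $ j else if (j, i) \<in> L then - cnj (M $ j $ i) else 0)" for M
  define w :: "complex^'n^'n \<Rightarrow> complex \<Rightarrow> complex" where
    "w M z = z + M $ (inv_into UNIV d z) $ (inv_into UNIV d z)" for M z
  define \<mu> where "\<mu> M i = w M (d i)" for M i
  define f where "f M = cayley (X M) ** diag_matrix (\<mu> M) ** conj_transpose (cayley (X M))" for M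
  let ?Q = "cball 0 r \<inter> span B"
  have nX: "norm (X M) \<le> 1 / 2" if "M \<in> ?Q" for M
  proof -
    have "norm (X M $ i $ j) \<le> r" for i j
      using norm_entry_le[of M i j] norm_entry_le[of M j i] that r0 by (auto simp: X_def)
    then have "norm (X M) \<le> K * r" unfolding K_def by (rule norm_matrix_le_entries)
    then show ?thesis using Kr by simp
  qed
  have skew: "conj_transpose (X M) = - X M" for M
  proof -
    have "conj_transpose (X M) $ i $ j = (- X M) $ i $ j" for i j
      using L(2)[of i j] by (auto simp: X_def)
    then show ?thesis by (simp add: vec_eq_iff)
  qed
  have Xblock: "X M $ i $ j = 0" if "d i = d j" for M i j
    using L(2)[of i j] L(2)[of j i] that by (auto simp: X_def)
  have wz: "norm (w M z - z) \<le> \<delta> / 3" if "M \<in> ?Q" for M z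
    using norm_entry_le[of M "inv_into UNIV d z" "inv_into UNIV d z"] that r\<delta> by (auto simp: w_def)
  \<comment> \<open>With two different matrices this serves injectivity of \<open>f\<close>; with
    \<open>M = M'\<close> it shows that the eigenvalues of \<open>f M\<close> stay distinct.\<close>
  have sep: "w M (d i) \<noteq> w M' (d j)" if "M \<in> ?Q" "M' \<in> ?Q" "d i \<noteq> d j" for M M' i j
  proof
    assume "w M (d i) = w M' (d j)"
    then have "dist (d i) (d j) \<le> \<delta> / 3 + \<delta> / 3"
      using wz[OF that(1), of "d i"] wz[OF that(2), of "d j"] dist_triangle[of "d i" "d j" "w M (d i)"]
      by (simp add: dist_norm norm_minus_commute)
    then show False using \<delta>(1) \<delta>(2)[OF that(3)] by simp
  qed
  have "continuous_on ?Q f"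
  proof -
    have cX: "continuous_on ?Q X"
      unfolding X_def
    proof (intro continuous_on_vec_lambda)
      fix i j
      show "continuous_on ?Q (\<lambda>M. if (i, j) \<in> L then M $ i $ j
          else if (j, i) \<in> L then - cnj (M $ j $ i) else 0)"
        by (cases "(i, j) \<in> L"; cases "(j, i) \<in> L") (auto intro!: continuous_intros)
    qed
    have "continuous_on ?Q (\<lambda>M. cayley (X M))"
      by (rule continuous_on_cayley[OF cX, of "1 / 2"]) (use nX in auto)
    then show ?thesis
      unfolding f_def \<mu>_def w_def by (intro continuous_intros)
  qed
  moreover have "inj_on f ?Q"
  proof (rule inj_onI)
    fix M M' assume M: "M \<in> ?Q" and M': "M' \<in> ?Q" and eq: "f M = f M'"
    have 1: "norm (X M) < 1" "norm (X M') < 1" using nX M M' by fastforce+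
    have 2: "\<mu> M i = \<mu> M j" if "d i = d j" for i j using that by (simp add: \<mu>_def)
    have 3: "\<mu> M' i \<noteq> \<mu> M j" if "d i \<noteq> d j" for i j
      using sep[OF M' M that] by (simp add: \<mu>_def)
    note inj = cayley_conj_injective[of "X M" d "X M'" "\<mu> M" "\<mu> M'"]
    have XM: "X M = X M'"
      by (rule inj(1)) (fact 1 2 3 skew Xblock eq[unfolded f_def])+
    have \<mu>M: "\<mu> M = \<mu> M'"
      by (rule inj(2)) (fact 1 2 3 skew Xblock eq[unfolded f_def])+
    have "M $ i $ j = M' $ i $ j" for i j
    proof -
      \<comment> \<open>An entry is recovered from \<open>X\<close>, or from the eigenvalue shift,
        or is zero by the description of \<open>span B\<close>.\<close>
      consider "(i, j) \<in> L" | "i = j" "i \<in> inv_into UNIV d ` range d"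
        | "(i, j) \<notin> L" "\<not> (i = j \<and> i \<in> inv_into UNIV d ` range d)" by blast
      then show ?thesis
      proof cases
        case 1
        have "X M $ i $ j = X M' $ i $ j" using XM by simp
        then show ?thesis using 1 by (simp add: X_def)
      next
        case 2
        then obtain l where "i = inv_into UNIV d (d l)" by blast
        moreover have "\<mu> M l = \<mu> M' l" using \<mu>M by simp
        ultimately show ?thesis using 2 by (simp add: \<mu>_def w_def)
      next
        case 3
        then show ?thesis using M M' span by simp
      qed
    qed
    then show "M = M'" by (simp add: vec_eq_iff)
  qed
  ultimately have "manifold_of_dim (card B) (f ` (ball 0 r \<inter> span B))"
    using manifold_of_dim_injective_image[OF B] by blast
  moreover have "f 0 \<in> f ` (ball 0 r \<inter> span B)"
    using r0 by (auto intro!: imageI span_zero)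
  then have "f ` (ball 0 r \<inter> span B) \<noteq> {}" by blast
  moreover have "f ` (ball 0 r \<inter> span B) \<subseteq> normal_with_mults I k"
  proof clarify
    fix M assume "M \<in> ball 0 r" "M \<in> span B"
    then have M: "M \<in> ?Q" by auto
    have "unitary_matrix (cayley (X M))"
      using nX[OF M] skew by (intro unitary_cayley) auto
    \<comment> \<open>Injectivity of the shift keeps the fibres, and hence the multiplicities, those
      of \<open>d\<close>.\<close>
    moreover have winj: "inj_on (w M) (range d)"
      using sep[OF M M] by (auto simp: inj_on_def)
    have "range (\<mu> M) = w M ` range d" by (auto simp: \<mu>_def)
    then have "bij_betw (w M \<circ> of_nat) {1..I} (range (\<mu> M))"
      using bij_betw_trans[OF e, of "w M"] winj by (simp add: bij_betw_def)
    moreover have "card {j. \<mu> M j = (w M \<circ> of_nat) i} = k i" if i: "i \<in> {1..I}" for i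
    proof -
      have "of_nat i \<in> range d" using e i by (auto simp: bij_betw_def)
      then have "{j. \<mu> M j = (w M \<circ> of_nat) i} = {j. d j = of_nat i}"
        using winj by (auto simp: \<mu>_def inj_on_def)
      then show ?thesis using k[OF i] by simp
    qed
    ultimately show "f M \<in> normal_with_mults I k"
      unfolding f_def by (subst unitary_conj_in_normal_with_mults_iff) blast+
  qed
  ultimately show ?thesis using that card by blast
qed

theorem corollary2p1:
  fixes I :: nat and k :: "nat \<Rightarrow> nat"
  assumes "\<And>i. i \<in> {1..I} \<Longrightarrow> k i > 0"
    and "(\<Sum>i=1..I. k i) = CARD('n::finite)"
  shows "int (real_dim (normal_with_mults I k :: (complex^'n^'n) set))
           = (int CARD('n))\<^sup>2 - (\<Sum>i=1..I. (int (k i))\<^sup>2) + 2 * int I"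
proof -
  obtain T :: "(complex^'n^'n) set" and m where T: "T \<subseteq> normal_with_mults I k" "T \<noteq> {}" "manifold_of_dim m T"
    and m: "int m = (int CARD('n))\<^sup>2 - (\<Sum>i=1..I. (int (k i))\<^sup>2) + 2 * int I"
    by (rule exists_manifold_in_normal_with_mults[OF assms])
  have "real_dim (normal_with_mults I k :: (complex^'n^'n) set) = m"
  proof (rule real_dim_eqI[OF T])
    fix T' :: "(complex^'n^'n) set" and e
    assume "T' \<subseteq> normal_with_mults I k" "T' \<noteq> {}" "manifold_of_dim e T'"
    then have "int e \<le> int m" unfolding m by (rule manifold_dim_le_normal_with_mults)
    then show "e \<le> m" by simp
  qed
  then show ?thesis using m by simp
qed

end
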